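(* Let $\mathcal{A}$ be a bicomplete, locally small abelian category and let $\mathcal{C}=\{\sigma_i:S_i\hookrightarrow1_{\mathcal{A}}\}_{i\in I}$ be a collection (with $I$ a class, not necessarily a set) of idempotent preradicals of $\mathcal{A}$. Then the join $\bigvee_{i\in I}\sigma_i$ in $Pr(\mathcal{A})$ is an idempotent preradical.
   Context: Bicomplete means complete and cocomplete; locally small means that the class of subobjects of each object is a set. A preradical of an abelian category $\mathcal{A}$ is a subobject of the identity functor $1_{\mathcal{A}}$ in the (possibly extended) abelian category $\mathrm{Fun}(\mathcal{A},\mathcal{A})$, i.e. the equivalence class of a monomorphic natural transformation $\tau:T\hookrightarrow 1_{\mathcal{A}}$, two such being equivalent if each factors through the other. $Pr(\mathcal{A})$ is the collection of preradicals, ordered by $\tau\leq\sigma$ iff $\tau$ factors through $\sigma$; under the stated hypotheses on $\mathcal{A}$ every collection of preradicals has a join (least upper bound) $\bigvee$ and a meet (greatest lower bound) $\bigwedge$. For $\tau:T\hookrightarrow 1_{\mathcal{A}}$ and $\sigma:S\hookrightarrow 1_{\mathcal{A}}$, the product $\tau\cdot\sigma$ is the class of $\sigma\circ\tau S=\tau\circ T\sigma:TS\to 1_{\mathcal{A}}$ (where $(\tau S)_A=\tau_{S(A)}$, $(T\sigma)_A=T(\sigma_A)$). The preradical $\tau$ is idempotent if $\tau\cdot\tau=\tau$. *)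

theory Defs
  imports "HOL-Algebra.Group" "HOL-Algebra.Lattice" "HOL-Library.FuncSet" "HOL-Library.Equipollence"
begin

section \<open>Categories\<close>

text \<open>The composite \<open>g \<odot> f\<close> means "first \<open>f\<close>, then \<open>g\<close>".  Nothing is required of any of the
  operations outside the carriers \<open>Obj\<close> and \<open>Arr\<close>.\<close>

record ('o, 'a) cat =
  Obj :: "'o set"
  Arr :: "'a set"
  Dom :: "'a \<Rightarrow> 'o"
  Cod :: "'a \<Rightarrow> 'o"
  Ident :: "'o \<Rightarrow> 'a"
  Comp :: "'a \<Rightarrow> 'a \<Rightarrow> 'a"  (infixl \<open>\<odot>\<index>\<close> 70)

definition Hom :: "('o, 'a, 'm) cat_scheme \<Rightarrow> 'o \<Rightarrow> 'o \<Rightarrow> 'a set" where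
  "Hom C X Y = {f \<in> Arr C. Dom C f = X \<and> Cod C f = Y}"

locale category =
  fixes C :: "('o, 'a, 'm) cat_scheme" (structure)
  assumes Dom_closed: "f \<in> Arr C \<Longrightarrow> Dom C f \<in> Obj C"
    and Cod_closed: "f \<in> Arr C \<Longrightarrow> Cod C f \<in> Obj C"
    and Ident_in_Hom: "X \<in> Obj C \<Longrightarrow> Ident C X \<in> Hom C X X"
    and Comp_in_Hom: "\<lbrakk>f \<in> Hom C X Y; g \<in> Hom C Y Z\<rbrakk> \<Longrightarrow> g \<odot> f \<in> Hom C X Z"
    and Comp_Ident: "f \<in> Hom C X Y \<Longrightarrow> f \<odot> Ident C X = f"
    and Ident_Comp: "f \<in> Hom C X Y \<Longrightarrow> Ident C Y \<odot> f = f"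
    and Comp_assoc: "\<lbrakk>f \<in> Hom C W X; g \<in> Hom C X Y; h \<in> Hom C Y Z\<rbrakk>
                      \<Longrightarrow> (h \<odot> g) \<odot> f = h \<odot> (g \<odot> f)"

definition monic :: "('o, 'a, 'm) cat_scheme \<Rightarrow> 'a \<Rightarrow> bool" where
  "monic C m \<longleftrightarrow> m \<in> Arr C \<and>
     (\<forall>X. \<forall>f \<in> Hom C X (Dom C m). \<forall>g \<in> Hom C X (Dom C m).
        m \<odot>\<^bsub>C\<^esub> f = m \<odot>\<^bsub>C\<^esub> g \<longrightarrow> f = g)"

definition epic :: "('o, 'a, 'm) cat_scheme \<Rightarrow> 'a \<Rightarrow> bool" where
  "epic C e \<longleftrightarrow> e \<in> Arr C \<and>
     (\<forall>Y. \<forall>f \<in> Hom C (Cod C e) Y. \<forall>g \<in> Hom C (Cod C e) Y.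
        f \<odot>\<^bsub>C\<^esub> e = g \<odot>\<^bsub>C\<^esub> e \<longrightarrow> f = g)"


section \<open>Subobjects\<close>

definition monics_into :: "('o, 'a, 'm) cat_scheme \<Rightarrow> 'o \<Rightarrow> 'a set" where
  "monics_into C X = {m. monic C m \<and> Cod C m = X}"

definition factors_through :: "('o, 'a, 'm) cat_scheme \<Rightarrow> 'a \<Rightarrow> 'a \<Rightarrow> bool" where
  "factors_through C m n \<longleftrightarrow> (\<exists>u \<in> Hom C (Dom C m) (Dom C n). m = n \<odot>\<^bsub>C\<^esub> u)"

definition subobject_rel :: "('o, 'a, 'm) cat_scheme \<Rightarrow> 'o \<Rightarrow> ('a \<times> 'a) set" where
  "subobject_rel C X = {(m, n). m \<in> monics_into C X \<and> n \<in> monics_into C X \<and>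
                                factors_through C m n \<and> factors_through C n m}"

definition Sub :: "('o, 'a, 'm) cat_scheme \<Rightarrow> 'o \<Rightarrow> 'a set set" where
  "Sub C X = monics_into C X // subobject_rel C X"

definition subobject_order :: "('o, 'a, 'm) cat_scheme \<Rightarrow> 'o \<Rightarrow> 'a set gorder" where
  "subobject_order C X =
     \<lparr>carrier = Sub C X, eq = (=), le = (\<lambda>P Q. \<exists>m \<in> P. \<exists>n \<in> Q. factors_through C m n)\<rparr>"


section \<open>Abelian categories\<close>

record ('o, 'a) preadd_cat = "('o, 'a) cat" +
  Add :: "'a \<Rightarrow> 'a \<Rightarrow> 'a"  (infixl \<open>\<boxplus>\<index>\<close> 65)
  Zero :: "'o \<Rightarrow> 'o \<Rightarrow> 'a"

definition hom_group :: "('o, 'a, 'm) preadd_cat_scheme \<Rightarrow> 'o \<Rightarrow> 'o \<Rightarrow> 'a monoid" where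
  "hom_group C X Y = \<lparr>carrier = Hom C X Y, mult = Add C, one = Zero C X Y\<rparr>"

locale preadditive_category = category C
  for C :: "('o, 'a, 'm) preadd_cat_scheme" (structure) +
  assumes hom_comm_group: "\<lbrakk>X \<in> Obj C; Y \<in> Obj C\<rbrakk> \<Longrightarrow> comm_group (hom_group C X Y)"
    and Comp_Add: "\<lbrakk>f \<in> Hom C X Y; f' \<in> Hom C X Y; g \<in> Hom C Y Z\<rbrakk>
                    \<Longrightarrow> g \<odot> (f \<boxplus> f') = (g \<odot> f) \<boxplus> (g \<odot> f')"
    and Add_Comp: "\<lbrakk>f \<in> Hom C X Y; g \<in> Hom C Y Z; g' \<in> Hom C Y Z\<rbrakk>
                    \<Longrightarrow> (g \<boxplus> g') \<odot> f = (g \<odot> f) \<boxplus> (g' \<odot> f)"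

definition is_zero_object :: "('o, 'a, 'm) cat_scheme \<Rightarrow> 'o \<Rightarrow> bool" where
  "is_zero_object C Z \<longleftrightarrow> Z \<in> Obj C \<and>
     (\<forall>X \<in> Obj C. (\<exists>!f. f \<in> Hom C X Z) \<and> (\<exists>!f. f \<in> Hom C Z X))"

definition is_biproduct ::
  "('o, 'a, 'm) preadd_cat_scheme \<Rightarrow> 'o \<Rightarrow> 'o \<Rightarrow> 'o \<Rightarrow> 'a \<Rightarrow> 'a \<Rightarrow> 'a \<Rightarrow> 'a \<Rightarrow> bool" where
  "is_biproduct C X Y P p q i j \<longleftrightarrow> P \<in> Obj C \<and>
     p \<in> Hom C P X \<and> q \<in> Hom C P Y \<and> i \<in> Hom C X P \<and> j \<in> Hom C Y P \<and>
     p \<odot>\<^bsub>C\<^esub> i = Ident C X \<and> q \<odot>\<^bsub>C\<^esub> j = Ident C Y \<and>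
     p \<odot>\<^bsub>C\<^esub> j = Zero C Y X \<and> q \<odot>\<^bsub>C\<^esub> i = Zero C X Y \<and>
     (i \<odot>\<^bsub>C\<^esub> p) \<boxplus>\<^bsub>C\<^esub> (j \<odot>\<^bsub>C\<^esub> q) = Ident C P"

definition is_kernel :: "('o, 'a, 'm) preadd_cat_scheme \<Rightarrow> 'a \<Rightarrow> 'a \<Rightarrow> bool" where
  "is_kernel C f k \<longleftrightarrow> k \<in> Arr C \<and> Cod C k = Dom C f \<and>
     f \<odot>\<^bsub>C\<^esub> k = Zero C (Dom C k) (Cod C f) \<and>
     (\<forall>W. \<forall>h \<in> Hom C W (Dom C f). f \<odot>\<^bsub>C\<^esub> h = Zero C W (Cod C f) \<longrightarrow>
        (\<exists>!u. u \<in> Hom C W (Dom C k) \<and> k \<odot>\<^bsub>C\<^esub> u = h))"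

definition is_cokernel :: "('o, 'a, 'm) preadd_cat_scheme \<Rightarrow> 'a \<Rightarrow> 'a \<Rightarrow> bool" where
  "is_cokernel C f c \<longleftrightarrow> c \<in> Arr C \<and> Dom C c = Cod C f \<and>
     c \<odot>\<^bsub>C\<^esub> f = Zero C (Dom C f) (Cod C c) \<and>
     (\<forall>W. \<forall>h \<in> Hom C (Cod C f) W. h \<odot>\<^bsub>C\<^esub> f = Zero C (Dom C f) W \<longrightarrow>
        (\<exists>!u. u \<in> Hom C (Cod C c) W \<and> u \<odot>\<^bsub>C\<^esub> c = h))"

locale abelian_category = preadditive_category C
  for C :: "('o, 'a, 'm) preadd_cat_scheme" (structure) +
  assumes zero_object_exists: "\<exists>Z. is_zero_object C Z"
    and biproduct_exists: "\<lbrakk>X \<in> Obj C; Y \<in> Obj C\<rbrakk> \<Longrightarrow> \<exists>P p q i j. is_biproduct C X Y P p q i j"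
    and kernel_exists: "f \<in> Arr C \<Longrightarrow> \<exists>k. is_kernel C f k"
    and cokernel_exists: "f \<in> Arr C \<Longrightarrow> \<exists>c. is_cokernel C f c"
    and monic_is_kernel: "monic C m \<Longrightarrow> \<exists>f \<in> Arr C. is_kernel C f m"
    and epic_is_cokernel: "epic C e \<Longrightarrow> \<exists>f \<in> Arr C. is_cokernel C f e"


section \<open>Functors and natural transformations\<close>

text \<open>Object maps, arrow maps and components are extensional functions, so that equality of
  functors and of natural transformations is equality in HOL.\<close>

record ('i, 'j, 'o, 'a) func =
  OMap :: "'i \<Rightarrow> 'o"
  AMap :: "'j \<Rightarrow> 'a"

definition is_functor ::
  "('i, 'j, 'n) cat_scheme \<Rightarrow> ('o, 'a, 'm) cat_scheme \<Rightarrow> ('i, 'j, 'o, 'a) func \<Rightarrow> bool" where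
  "is_functor J C F \<longleftrightarrow>
     OMap F \<in> Obj J \<rightarrow>\<^sub>E Obj C \<and> AMap F \<in> Arr J \<rightarrow>\<^sub>E Arr C \<and>
     (\<forall>f \<in> Arr J. AMap F f \<in> Hom C (OMap F (Dom J f)) (OMap F (Cod J f))) \<and>
     (\<forall>X \<in> Obj J. AMap F (Ident J X) = Ident C (OMap F X)) \<and>
     (\<forall>X Y Z. \<forall>f \<in> Hom J X Y. \<forall>g \<in> Hom J Y Z.
        AMap F (g \<odot>\<^bsub>J\<^esub> f) = AMap F g \<odot>\<^bsub>C\<^esub> AMap F f)"

definition id_functor :: "('o, 'a, 'm) cat_scheme \<Rightarrow> ('o, 'a, 'o, 'a) func" where
  "id_functor C = \<lparr>OMap = (\<lambda>X \<in> Obj C. X), AMap = (\<lambda>f \<in> Arr C. f)\<rparr>"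

definition comp_functor ::
  "('h, 'k, 'n) cat_scheme \<Rightarrow> ('i, 'j, 'o, 'a) func \<Rightarrow> ('h, 'k, 'i, 'j) func \<Rightarrow> ('h, 'k, 'o, 'a) func"
where
  "comp_functor B G F =
     \<lparr>OMap = (\<lambda>X \<in> Obj B. OMap G (OMap F X)), AMap = (\<lambda>f \<in> Arr B. AMap G (AMap F f))\<rparr>"

record ('i, 'j, 'o, 'a) nat_trans =
  Src :: "('i, 'j, 'o, 'a) func"
  Tgt :: "('i, 'j, 'o, 'a) func"
  Component :: "'i \<Rightarrow> 'a"

definition is_nat_trans ::
  "('i, 'j, 'n) cat_scheme \<Rightarrow> ('o, 'a, 'm) cat_scheme \<Rightarrow> ('i, 'j, 'o, 'a) nat_trans \<Rightarrow> bool" where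
  "is_nat_trans J C t \<longleftrightarrow>
     is_functor J C (Src t) \<and> is_functor J C (Tgt t) \<and> Component t \<in> extensional (Obj J) \<and>
     (\<forall>X \<in> Obj J. Component t X \<in> Hom C (OMap (Src t) X) (OMap (Tgt t) X)) \<and>
     (\<forall>X Y. \<forall>f \<in> Hom J X Y.
        Component t Y \<odot>\<^bsub>C\<^esub> AMap (Src t) f = AMap (Tgt t) f \<odot>\<^bsub>C\<^esub> Component t X)"

definition Fun ::
  "('i, 'j, 'n) cat_scheme \<Rightarrow> ('o, 'a, 'm) cat_scheme \<Rightarrow>
   (('i, 'j, 'o, 'a) func, ('i, 'j, 'o, 'a) nat_trans) cat" where
  "Fun J C =
     \<lparr>Obj = {F. is_functor J C F},
      Arr = {t. is_nat_trans J C t},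
      Dom = Src,
      Cod = Tgt,
      Ident = (\<lambda>F. \<lparr>Src = F, Tgt = F, Component = (\<lambda>X \<in> Obj J. Ident C (OMap F X))\<rparr>),
      Comp = (\<lambda>s t. \<lparr>Src = Src t, Tgt = Tgt s,
                      Component = (\<lambda>X \<in> Obj J. Component s X \<odot>\<^bsub>C\<^esub> Component t X)\<rparr>)\<rparr>"

text \<open>For \<open>t : F \<rightarrow> G\<close> and \<open>S : B \<rightarrow> J\<close>, the transformation \<open>tS : FS \<rightarrow> GS\<close> with
  \<open>(tS)\<^sub>X = t\<^bsub>S(X)\<^esub>\<close>.\<close>

definition whisker ::
  "('h, 'k, 'n) cat_scheme \<Rightarrow> ('i, 'j, 'o, 'a) nat_trans \<Rightarrow> ('h, 'k, 'i, 'j) func \<Rightarrow>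
   ('h, 'k, 'o, 'a) nat_trans" where
  "whisker B t S =
     \<lparr>Src = comp_functor B (Src t) S, Tgt = comp_functor B (Tgt t) S,
      Component = (\<lambda>X \<in> Obj B. Component t (OMap S X))\<rparr>"


section \<open>Smallness\<close>

text \<open>The type \<open>'u\<close> plays the role of the universe of all sets: a collection is small (a set rather
  than a proper class) iff its cardinality is strictly smaller than that of \<open>'u\<close>.  If \<open>'u\<close> has
  inaccessible cardinality, this is smallness with respect to the corresponding Grothendieck
  universe.  No closure property of \<open>'u\<close> is assumed.\<close>

definition small :: "'u itself \<Rightarrow> 'b set \<Rightarrow> bool" where
  "small _ B \<longleftrightarrow> B \<prec> (UNIV :: 'u set)"

definition is_cone ::
  "('i, 'j, 'n) cat_scheme \<Rightarrow> ('o, 'a, 'm) cat_scheme \<Rightarrow> ('i, 'j, 'o, 'a) func \<Rightarrow>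
   'o \<Rightarrow> ('i \<Rightarrow> 'a) \<Rightarrow> bool" where
  "is_cone J C F X p \<longleftrightarrow> X \<in> Obj C \<and>
     (\<forall>j \<in> Obj J. p j \<in> Hom C X (OMap F j)) \<and>
     (\<forall>f \<in> Arr J. AMap F f \<odot>\<^bsub>C\<^esub> p (Dom J f) = p (Cod J f))"

definition is_limit ::
  "('i, 'j, 'n) cat_scheme \<Rightarrow> ('o, 'a, 'm) cat_scheme \<Rightarrow> ('i, 'j, 'o, 'a) func \<Rightarrow>
   'o \<Rightarrow> ('i \<Rightarrow> 'a) \<Rightarrow> bool" where
  "is_limit J C F X p \<longleftrightarrow> is_cone J C F X p \<and>
     (\<forall>Y q. is_cone J C F Y q \<longrightarrow>
        (\<exists>!u. u \<in> Hom C Y X \<and> (\<forall>j \<in> Obj J. p j \<odot>\<^bsub>C\<^esub> u = q j)))"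

definition is_cocone ::
  "('i, 'j, 'n) cat_scheme \<Rightarrow> ('o, 'a, 'm) cat_scheme \<Rightarrow> ('i, 'j, 'o, 'a) func \<Rightarrow>
   'o \<Rightarrow> ('i \<Rightarrow> 'a) \<Rightarrow> bool" where
  "is_cocone J C F X p \<longleftrightarrow> X \<in> Obj C \<and>
     (\<forall>j \<in> Obj J. p j \<in> Hom C (OMap F j) X) \<and>
     (\<forall>f \<in> Arr J. p (Cod J f) \<odot>\<^bsub>C\<^esub> AMap F f = p (Dom J f))"

definition is_colimit ::
  "('i, 'j, 'n) cat_scheme \<Rightarrow> ('o, 'a, 'm) cat_scheme \<Rightarrow> ('i, 'j, 'o, 'a) func \<Rightarrow>
   'o \<Rightarrow> ('i \<Rightarrow> 'a) \<Rightarrow> bool" where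
  "is_colimit J C F X p \<longleftrightarrow> is_cocone J C F X p \<and>
     (\<forall>Y q. is_cocone J C F Y q \<longrightarrow>
        (\<exists>!u. u \<in> Hom C X Y \<and> (\<forall>j \<in> Obj J. u \<odot>\<^bsub>C\<^esub> p j = q j)))"

text \<open>Every small category, over whatever types, is isomorphic to one whose objects and arrows
  are elements of \<open>'u\<close>, so quantifying over the latter loses no diagrams.\<close>

definition complete_cat :: "'u itself \<Rightarrow> ('o, 'a, 'm) cat_scheme \<Rightarrow> bool" where
  "complete_cat U C \<longleftrightarrow>
     (\<forall>(J :: ('u, 'u) cat) F.
        category J \<and> small U (Obj J) \<and> small U (Arr J) \<and> is_functor J C F \<longrightarrow>
        (\<exists>X p. is_limit J C F X p))"

definition cocomplete_cat :: "'u itself \<Rightarrow> ('o, 'a, 'm) cat_scheme \<Rightarrow> bool" where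
  "cocomplete_cat U C \<longleftrightarrow>
     (\<forall>(J :: ('u, 'u) cat) F.
        category J \<and> small U (Obj J) \<and> small U (Arr J) \<and> is_functor J C F \<longrightarrow>
        (\<exists>X p. is_colimit J C F X p))"

definition bicomplete_cat :: "'u itself \<Rightarrow> ('o, 'a, 'm) cat_scheme \<Rightarrow> bool" where
  "bicomplete_cat U C \<longleftrightarrow> complete_cat U C \<and> cocomplete_cat U C"

text \<open>"Locally small" concerns subobjects here, not hom-sets; it is also called "well-powered".\<close>

definition locally_small :: "'u itself \<Rightarrow> ('o, 'a, 'm) cat_scheme \<Rightarrow> bool" where
  "locally_small U C \<longleftrightarrow> (\<forall>X \<in> Obj C. small U (Sub C X))"


section \<open>Preradicals\<close>

type_synonym ('o, 'a) preradical = "('o, 'a, 'o, 'a) nat_trans set"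

definition Pr :: "('o, 'a, 'm) cat_scheme \<Rightarrow> ('o, 'a) preradical gorder" where
  "Pr A = subobject_order (Fun A A) (id_functor A)"

text \<open>The class of \<open>\<sigma> \<circ> \<tau>S\<close>, for representatives \<open>\<tau> : T \<rightarrow> 1\<close> of \<open>P\<close> and \<open>\<sigma> : S \<rightarrow> 1\<close> of \<open>Q\<close>.
  The union over all representatives is a single class, since that class does not depend on
  their choice.\<close>

definition preradical_mult ::
  "('o, 'a, 'm) cat_scheme \<Rightarrow> ('o, 'a) preradical \<Rightarrow> ('o, 'a) preradical \<Rightarrow> ('o, 'a) preradical"
where
  "preradical_mult A P Q =
     (\<Union>\<tau> \<in> P. \<Union>\<sigma> \<in> Q.
        subobject_rel (Fun A A) (id_functor A) `` {\<sigma> \<odot>\<^bsub>Fun A A\<^esub> whisker A \<tau> (Src \<sigma>)})"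

definition idempotent_preradical :: "('o, 'a, 'm) cat_scheme \<Rightarrow> ('o, 'a) preradical \<Rightarrow> bool" where
  "idempotent_preradical A P \<longleftrightarrow> P \<in> carrier (Pr A) \<and> preradical_mult A P P = P"

end

theory Submission
  imports Defs
begin

text \<open>In \<open>A\<close> the join of a family of subobjects of \<open>X\<close> is the smallest subobject through which they
  all factor, and an arrow out of \<open>X\<close> kills the join as soon as it kills every member. Hence the
  pointwise joins \<open>t\<^sub>X\<close> of a class of preradicals form a preradical \<open>t\<close>, its join in \<open>Pr A\<close>. The
  product of preradicals is monotone in both arguments, so if every member \<open>s\<close> is idempotent, then
  \<open>s \<le> s \<cdot> s \<le> t \<cdot> t\<close>, and therefore \<open>t \<le> t \<cdot> t\<close>. The reverse inequality always holds.\<close>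

section \<open>Subobjects in a category\<close>

text \<open>The members may form a proper class, so the colimits at hand do not give a coproduct of
  them directly. At a single object, however, their components represent only a small family of
  subobjects, and the join can be formed there. This presupposes that a monomorphism of functors has
  monic components, which comes from pointwise kernels. The joins at different objects are chosen
  independently, so compatibility with arrows has to be proved. Annihilators do it. A monic
  \<open>n\<close> is a kernel, so \<open>m\<close> factors through \<open>n\<close> once every
  \<open>g\<close> killing \<open>n\<close> kills \<open>m\<close>. For \<open>f : X -> Y\<close>,
  let \<open>g\<close> kill \<open>t_Y\<close>. Then \<open>g\<close> kills \<open>s_Y\<close> for
  every member \<open>s : S -> 1\<close>, so \<open>g f s_X = g s_Y S(f) = 0\<close>, hence
  \<open>g f\<close> kills the join \<open>t_X\<close>. Thus \<open>f t_X\<close> factors through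
  \<open>t_Y\<close>. Monotonicity of the product in its second factor is not formal: it rests on
  naturality of the first factor.\<close>

lemma HomI: "\<lbrakk>f \<in> Arr C; Dom C f = X; Cod C f = Y\<rbrakk> \<Longrightarrow> f \<in> Hom C X Y"
  by (simp add: Hom_def)

lemma HomD:
  assumes "f \<in> Hom C X Y"
  shows "f \<in> Arr C" "Dom C f = X" "Cod C f = Y"
  using assms by (simp_all add: Hom_def)

lemma monicD: "\<lbrakk>monic C m; m \<odot>\<^bsub>C\<^esub> f = m \<odot>\<^bsub>C\<^esub> g; f \<in> Hom C X (Dom C m); g \<in> Hom C X (Dom C m)\<rbrakk> \<Longrightarrow> f = g"
  unfolding monic_def by blast

lemma monics_intoD:
  assumes "m \<in> monics_into C X"
  shows "monic C m" "Cod C m = X" "m \<in> Arr C" "m \<in> Hom C (Dom C m) X"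
  using assms by (auto simp: monics_into_def monic_def Hom_def)

context category
begin

lemma Hom_Obj:
  assumes "f \<in> Hom C X Y"
  shows "X \<in> Obj C" "Y \<in> Obj C"
  using Dom_closed[of f] Cod_closed[of f] HomD[OF assms] by auto

lemma monic_Comp:
  assumes m: "monic C m" and n: "monic C n" and "Dom C m = Cod C n"
  shows "monic C (m \<odot> n)"
proof -
  have mH: "m \<in> Hom C (Cod C n) (Cod C m)" and nH: "n \<in> Hom C (Dom C n) (Cod C n)"
    using assms by (auto simp: monic_def Hom_def)
  have mn: "m \<odot> n \<in> Hom C (Dom C n) (Cod C m)" by (rule Comp_in_Hom[OF nH mH])
  show ?thesis
    unfolding monic_def
  proof (intro conjI allI ballI impI)
    show "m \<odot> n \<in> Arr C" using mn by (rule HomD)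
    fix W f g
    assume "f \<in> Hom C W (Dom C (m \<odot> n))" "g \<in> Hom C W (Dom C (m \<odot> n))"
      and eq: "m \<odot> n \<odot> f = m \<odot> n \<odot> g"
    then have f: "f \<in> Hom C W (Dom C n)" and g: "g \<in> Hom C W (Dom C n)"
      using HomD(2)[OF mn] by auto
    have "m \<odot> (n \<odot> f) = m \<odot> (n \<odot> g)"
      using eq Comp_assoc[OF f nH mH] Comp_assoc[OF g nH mH] by simp
    then have "n \<odot> f = n \<odot> g"
      using monicD[OF m] Comp_in_Hom[OF f nH] Comp_in_Hom[OF g nH] assms(3) by auto
    then show "f = g" using monicD[OF n] f g by blast
  qed
qed

lemma factors_through_refl: "m \<in> Arr C \<Longrightarrow> factors_through C m m"
  unfolding factors_through_def
  using Ident_in_Hom[OF Dom_closed] Comp_Ident[of m "Dom C m" "Cod C m"]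
  by (intro bexI[of _ "Ident C (Dom C m)"]) (auto simp: Hom_def)

lemma factors_through_trans:
  assumes "factors_through C l m" "factors_through C m n" "n \<in> Arr C"
  shows "factors_through C l n"
proof -
  obtain u where u: "u \<in> Hom C (Dom C l) (Dom C m)" "l = m \<odot> u"
    using assms(1) unfolding factors_through_def by blast
  obtain v where v: "v \<in> Hom C (Dom C m) (Dom C n)" "m = n \<odot> v"
    using assms(2) unfolding factors_through_def by blast
  have "n \<in> Hom C (Dom C n) (Cod C n)" using assms(3) by (simp add: Hom_def)
  then have "l = n \<odot> (v \<odot> u)" using Comp_assoc u v by metis
  then show ?thesis using Comp_in_Hom[OF u(1) v(1)] unfolding factors_through_def by blast
qed

lemma equiv_subobject_rel: "equiv (monics_into C X) (subobject_rel C X)"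
  unfolding equiv_def refl_on_def sym_def trans_def subobject_rel_def
  by (auto intro: factors_through_refl factors_through_trans dest: monics_intoD)

text \<open>Every member of a class generates it, so later arguments may work with whichever
  representative is at hand.\<close>

lemma Sub_memberD:
  assumes "P \<in> Sub C X" "m \<in> P"
  shows "m \<in> monics_into C X" "P = subobject_rel C X `` {m}"
proof -
  obtain n where n: "P = subobject_rel C X `` {n}" "n \<in> monics_into C X"
    using assms(1) unfolding Sub_def by (auto elim: quotientE)
  then show "m \<in> monics_into C X" using assms(2) by (auto simp: subobject_rel_def)
  show "P = subobject_rel C X `` {m}"
    using equiv_class_eq[OF equiv_subobject_rel] assms(2) n by fastforce
qed

lemma Sub_nonempty: "P \<in> Sub C X \<Longrightarrow> \<exists>m. m \<in> P"
  unfolding Sub_def by (metis in_quotient_imp_non_empty equiv_subobject_rel ex_in_conv)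

lemma Sub_class: "m \<in> monics_into C X \<Longrightarrow> subobject_rel C X `` {m} \<in> Sub C X"
  unfolding Sub_def by (rule quotientI)

lemma class_self: "m \<in> monics_into C X \<Longrightarrow> m \<in> subobject_rel C X `` {m}"
  by (rule equiv_class_self[OF equiv_subobject_rel])

text \<open>The order asks for one suitable pair of representatives. Members of a class factor
  through each other, so any pair decides.\<close>

lemma subobject_le_iff:
  assumes "P \<in> Sub C X" "Q \<in> Sub C X" "m \<in> P" "n \<in> Q"
  shows "P \<sqsubseteq>\<^bsub>subobject_order C X\<^esub> Q \<longleftrightarrow> factors_through C m n"
proof
  assume "P \<sqsubseteq>\<^bsub>subobject_order C X\<^esub> Q"
  then obtain m' n' where mn: "m' \<in> P" "n' \<in> Q" "factors_through C m' n'"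
    by (auto simp: subobject_order_def)
  have "factors_through C m m'"
    using Sub_memberD(2)[OF assms(1,3)] mn(1) by (auto simp: subobject_rel_def)
  moreover have "factors_through C n' n"
    using Sub_memberD(2)[OF assms(2,4)] mn(2) by (auto simp: subobject_rel_def)
  moreover have "n \<in> Arr C" "n' \<in> Arr C"
    using Sub_memberD(1) monics_intoD(3) assms mn(2) by metis+
  ultimately show "factors_through C m n"
    using mn(3) factors_through_trans by blast
next
  assume "factors_through C m n"
  then show "P \<sqsubseteq>\<^bsub>subobject_order C X\<^esub> Q"
    using assms by (auto simp: subobject_order_def)
qed

lemma subobject_le_antisym:
  assumes "P \<in> Sub C X" "Q \<in> Sub C X"
    and "P \<sqsubseteq>\<^bsub>subobject_order C X\<^esub> Q" "Q \<sqsubseteq>\<^bsub>subobject_order C X\<^esub> P"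
  shows "P = Q"
proof -
  obtain m n where m: "m \<in> P" and n: "n \<in> Q" using assms Sub_nonempty by meson
  have "(m, n) \<in> subobject_rel C X"
    using subobject_le_iff assms m n Sub_memberD(1) by (auto simp: subobject_rel_def)
  then show ?thesis
    using equiv_class_eq[OF equiv_subobject_rel] Sub_memberD(2) assms(1,2) m n by metis
qed

text \<open>Transfers a join of monics to classes. The bounds are tested on all members of
  \<open>\<Union>Ps\<close>, so no representatives have to be chosen for the classes in
  \<open>Ps\<close>.\<close>

lemma is_lub_subobject_order:
  assumes Ps: "Ps \<subseteq> Sub C X" and t: "t \<in> monics_into C X"
    and upper: "\<And>m. m \<in> \<Union>Ps \<Longrightarrow> factors_through C m t"
    and least: "\<And>n. \<lbrakk>n \<in> monics_into C X; \<And>m. m \<in> \<Union>Ps \<Longrightarrow> factors_through C m n\<rbrakk>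
                     \<Longrightarrow> factors_through C t n"
  shows "is_lub (subobject_order C X) (subobject_rel C X `` {t}) Ps"
proof -
  let ?L = "subobject_order C X" and ?T = "subobject_rel C X `` {t}"
  have carrier: "carrier ?L = Sub C X" by (simp add: subobject_order_def)
  have T: "?T \<in> Sub C X" "t \<in> ?T" using t Sub_class class_self by auto
  have "P \<sqsubseteq>\<^bsub>?L\<^esub> ?T" if P: "P \<in> Ps" for P
  proof -
    obtain m where "m \<in> P" using Sub_nonempty Ps P by blast
    then show ?thesis using subobject_le_iff[of P X ?T m t] T upper Ps P by blast
  qed
  moreover have "?T \<sqsubseteq>\<^bsub>?L\<^esub> Q" if Q: "Q \<in> Upper ?L Ps" for Q
  proof -
    have QS: "Q \<in> Sub C X" and PQ: "\<And>P. P \<in> Ps \<Longrightarrow> P \<sqsubseteq>\<^bsub>?L\<^esub> Q"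
      using Q Ps carrier by (auto simp: Upper_def)
    obtain n where n: "n \<in> Q" using Sub_nonempty QS by blast
    have "factors_through C m n" if "m \<in> \<Union>Ps" for m
      using that PQ subobject_le_iff[OF _ QS _ n] Ps by blast
    then have "factors_through C t n" using least Sub_memberD(1)[OF QS n] by blast
    then show ?thesis using subobject_le_iff[OF T(1) QS T(2) n] by simp
  qed
  ultimately show ?thesis
    using T(1) carrier by (auto simp: least_def Upper_def)
qed

end


section \<open>Functor categories\<close>

lemma Fun_simps [simp]:
  "F \<in> Obj (Fun J C) \<longleftrightarrow> is_functor J C F"
  "t \<in> Arr (Fun J C) \<longleftrightarrow> is_nat_trans J C t"
  "Dom (Fun J C) t = Src t"
  "Cod (Fun J C) t = Tgt t"
  "Ident (Fun J C) F = \<lparr>Src = F, Tgt = F, Component = (\<lambda>X \<in> Obj J. Ident C (OMap F X))\<rparr>"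
  "s \<odot>\<^bsub>Fun J C\<^esub> t = \<lparr>Src = Src t, Tgt = Tgt s,
      Component = (\<lambda>X \<in> Obj J. Component s X \<odot>\<^bsub>C\<^esub> Component t X)\<rparr>"
  by (auto simp: Fun_def)

lemma Hom_Fun_iff:
  "t \<in> Hom (Fun J C) F G \<longleftrightarrow> is_nat_trans J C t \<and> Src t = F \<and> Tgt t = G"
  by (simp add: Hom_def)

text \<open>Components are extensional, so they agree automatically outside
  \<open>Obj J\<close>.\<close>

lemma nat_trans_eqI:
  assumes "is_nat_trans J C s" "is_nat_trans J C t" "Src s = Src t" "Tgt s = Tgt t"
    and "\<And>X. X \<in> Obj J \<Longrightarrow> Component s X = Component t X"
  shows "s = t"
  using assms
  by (intro nat_trans.equality extensionalityI[of _ "Obj J"]) (auto simp: is_nat_trans_def)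

lemma Component_Hom:
  "\<lbrakk>is_nat_trans J C t; X \<in> Obj J\<rbrakk> \<Longrightarrow> Component t X \<in> Hom C (OMap (Src t) X) (OMap (Tgt t) X)"
  by (simp add: is_nat_trans_def)

lemma naturality:
  "\<lbrakk>is_nat_trans J C t; f \<in> Hom J X Y\<rbrakk>
    \<Longrightarrow> Component t Y \<odot>\<^bsub>C\<^esub> AMap (Src t) f = AMap (Tgt t) f \<odot>\<^bsub>C\<^esub> Component t X"
  unfolding is_nat_trans_def by blast

lemma AMap_Hom: "\<lbrakk>is_functor J C F; f \<in> Hom J X Y\<rbrakk> \<Longrightarrow> AMap F f \<in> Hom C (OMap F X) (OMap F Y)"
  by (auto simp: is_functor_def Hom_def)

lemma OMap_Obj: "\<lbrakk>is_functor J C F; X \<in> Obj J\<rbrakk> \<Longrightarrow> OMap F X \<in> Obj C"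
  by (auto simp: is_functor_def)

lemma AMap_Ident: "\<lbrakk>is_functor J C F; X \<in> Obj J\<rbrakk> \<Longrightarrow> AMap F (Ident J X) = Ident C (OMap F X)"
  by (auto simp: is_functor_def)

lemma AMap_Comp:
  "\<lbrakk>is_functor J C F; f \<in> Hom J X Y; g \<in> Hom J Y Z\<rbrakk>
    \<Longrightarrow> AMap F (g \<odot>\<^bsub>J\<^esub> f) = AMap F g \<odot>\<^bsub>C\<^esub> AMap F f"
  unfolding is_functor_def by blast

locale two_categories = J: category J + C: category C
  for J :: "('i, 'j, 'n) cat_scheme" and C :: "('o, 'a, 'm) cat_scheme"
begin

lemma nat_trans_Comp:
  assumes s: "is_nat_trans J C s" and t: "is_nat_trans J C t" and "Src s = Tgt t"
  shows "is_nat_trans J C (s \<odot>\<^bsub>Fun J C\<^esub> t)"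
proof -
  have "Component s Y \<odot>\<^bsub>C\<^esub> Component t Y \<odot>\<^bsub>C\<^esub> AMap (Src t) f
      = AMap (Tgt s) f \<odot>\<^bsub>C\<^esub> (Component s X \<odot>\<^bsub>C\<^esub> Component t X)"
    if f: "f \<in> Hom J X Y" for f X Y
  proof -
    have XY: "X \<in> Obj J" "Y \<in> Obj J" using J.Hom_Obj[OF f] by auto
    have F: "AMap (Src t) f \<in> Hom C (OMap (Src t) X) (OMap (Src t) Y)"
      and G: "AMap (Src s) f \<in> Hom C (OMap (Src s) X) (OMap (Src s) Y)"
      and H: "AMap (Tgt s) f \<in> Hom C (OMap (Tgt s) X) (OMap (Tgt s) Y)"
      using s t f by (auto intro!: AMap_Hom simp: is_nat_trans_def)
    note ts = Component_Hom[OF t XY(1)] Component_Hom[OF t XY(2)]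
      Component_Hom[OF s XY(1)] Component_Hom[OF s XY(2)]
    show ?thesis
      using C.Comp_assoc[OF F] C.Comp_assoc[OF _ _ H] C.Comp_assoc[OF _ G] ts
        naturality[OF s f] naturality[OF t f] assms(3) by metis
  qed
  moreover have "Component s X \<odot>\<^bsub>C\<^esub> Component t X \<in> Hom C (OMap (Src t) X) (OMap (Tgt s) X)"
    if "X \<in> Obj J" for X
    using C.Comp_in_Hom Component_Hom[OF t that] Component_Hom[OF s that] assms(3) by metis
  ultimately show ?thesis
    using s t J.Hom_Obj unfolding is_nat_trans_def Fun_simps by auto
qed

text \<open>Makes the subobject lemmas of \<open>category\<close> available in
  \<open>Fun J C\<close>, and thereby in \<open>Pr\<close>.\<close>

lemma category_Fun: "category (Fun J C)"
proof
  show "Dom (Fun J C) t \<in> Obj (Fun J C)" "Cod (Fun J C) t \<in> Obj (Fun J C)"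
    if "t \<in> Arr (Fun J C)" for t
    using that by (auto simp: is_nat_trans_def)
  show Id: "Ident (Fun J C) F \<in> Hom (Fun J C) F F" if "F \<in> Obj (Fun J C)" for F
  proof -
    have F: "is_functor J C F" using that by simp
    have "Ident C (OMap F Y) \<odot>\<^bsub>C\<^esub> AMap F f = AMap F f \<odot>\<^bsub>C\<^esub> Ident C (OMap F X)"
      if "f \<in> Hom J X Y" for f X Y
      using C.Comp_Ident[OF AMap_Hom[OF F that]] C.Ident_Comp[OF AMap_Hom[OF F that]] by simp
    then show ?thesis
      using F J.Hom_Obj C.Ident_in_Hom[OF OMap_Obj[OF F]]
      by (auto simp: Hom_Fun_iff is_nat_trans_def)
  qed
  show Co: "g \<odot>\<^bsub>Fun J C\<^esub> f \<in> Hom (Fun J C) X Z"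
    if "f \<in> Hom (Fun J C) X Y" "g \<in> Hom (Fun J C) Y Z" for f g X Y Z
    using that nat_trans_Comp[of g f] by (simp add: Hom_Fun_iff)
  show "f \<odot>\<^bsub>Fun J C\<^esub> Ident (Fun J C) X = f" if f: "f \<in> Hom (Fun J C) X Y" for f X Y
  proof -
    have f': "is_nat_trans J C f" "Src f = X" "Tgt f = Y" "is_functor J C X"
      using f by (auto simp: Hom_Fun_iff is_nat_trans_def)
    have "is_nat_trans J C (f \<odot>\<^bsub>Fun J C\<^esub> Ident (Fun J C) X)"
      using HomD(1)[OF Co[OF Id f]] f'(4) by simp
    then show ?thesis
      by (rule nat_trans_eqI)
        (use f' C.Comp_Ident[OF Component_Hom[OF f'(1)]] in simp_all)
  qed
  show "Ident (Fun J C) Y \<odot>\<^bsub>Fun J C\<^esub> f = f" if f: "f \<in> Hom (Fun J C) X Y" for f X Y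
  proof -
    have f': "is_nat_trans J C f" "Src f = X" "Tgt f = Y" "is_functor J C Y"
      using f by (auto simp: Hom_Fun_iff is_nat_trans_def)
    have "is_nat_trans J C (Ident (Fun J C) Y \<odot>\<^bsub>Fun J C\<^esub> f)"
      using HomD(1)[OF Co[OF f Id]] f'(4) by simp
    then show ?thesis
      by (rule nat_trans_eqI)
        (use f' C.Ident_Comp[OF Component_Hom[OF f'(1)]] in simp_all)
  qed
  show "h \<odot>\<^bsub>Fun J C\<^esub> g \<odot>\<^bsub>Fun J C\<^esub> f = h \<odot>\<^bsub>Fun J C\<^esub> (g \<odot>\<^bsub>Fun J C\<^esub> f)"
    if f: "f \<in> Hom (Fun J C) W X" and g: "g \<in> Hom (Fun J C) X Y" and h: "h \<in> Hom (Fun J C) Y Z"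
    for f g h W X Y Z
  proof -
    have fH: "Component f x \<in> Hom C (OMap W x) (OMap X x)"
      and gH: "Component g x \<in> Hom C (OMap X x) (OMap Y x)"
      and hH: "Component h x \<in> Hom C (OMap Y x) (OMap Z x)" if "x \<in> Obj J" for x
      using Component_Hom[OF _ that, of C f] Component_Hom[OF _ that, of C g]
        Component_Hom[OF _ that, of C h] f g h by (simp_all add: Hom_Fun_iff)
    show ?thesis
      using C.Comp_assoc[OF fH gH hH] by (auto simp: fun_eq_iff restrict_def)
  qed
qed

lemma monic_FunI:
  assumes t: "is_nat_trans J C t" and m: "\<And>X. X \<in> Obj J \<Longrightarrow> monic C (Component t X)"
  shows "monic (Fun J C) t"
  unfolding monic_def
proof (intro conjI allI ballI impI)
  show "t \<in> Arr (Fun J C)" using t by simp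
  fix F f g
  assume "f \<in> Hom (Fun J C) F (Dom (Fun J C) t)" "g \<in> Hom (Fun J C) F (Dom (Fun J C) t)"
    and eq: "t \<odot>\<^bsub>Fun J C\<^esub> f = t \<odot>\<^bsub>Fun J C\<^esub> g"
  then have fg: "is_nat_trans J C f" "is_nat_trans J C g" "Src f = F" "Src g = F"
    "Tgt f = Src t" "Tgt g = Src t" by (auto simp: Hom_Fun_iff)
  show "f = g"
  proof (rule nat_trans_eqI[OF fg(1,2)])
    fix X assume X: "X \<in> Obj J"
    have "Component t X \<odot>\<^bsub>C\<^esub> Component f X = Component t X \<odot>\<^bsub>C\<^esub> Component g X"
      using eq X by (auto dest: fun_cong[of _ _ X])
    then show "Component f X = Component g X"
      using monicD[OF m[OF X]] Component_Hom[OF fg(1) X] Component_Hom[OF fg(2) X] fg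
        HomD(2)[OF Component_Hom[OF t X]] by metis
  qed (use fg in auto)
qed

text \<open>Each component of \<open>t\<close> is monic, so the pointwise factorizations are unique.
  Uniqueness makes them natural: both sides of the naturality square agree after composition with
  \<open>t\<close> and can be cancelled.\<close>

lemma factors_through_FunI:
  assumes s: "is_nat_trans J C s" and t: "is_nat_trans J C t" and tgt: "Tgt s = Tgt t"
    and m: "\<And>X. X \<in> Obj J \<Longrightarrow> monic C (Component t X)"
    and le: "\<And>X. X \<in> Obj J \<Longrightarrow> factors_through C (Component s X) (Component t X)"
  shows "factors_through (Fun J C) s t"
proof -
  note sH = Component_Hom[OF s] and tH = Component_Hom[OF t]
  have "\<exists>v. v \<in> Hom C (OMap (Src s) X) (OMap (Src t) X) \<and>
        Component s X = Component t X \<odot>\<^bsub>C\<^esub> v" if "X \<in> Obj J" for X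
    using le[OF that] HomD(2)[OF sH[OF that]] HomD(2)[OF tH[OF that]]
    unfolding factors_through_def by auto
  then obtain v where v: "\<And>X. X \<in> Obj J \<Longrightarrow> v X \<in> Hom C (OMap (Src s) X) (OMap (Src t) X)"
    and sv: "\<And>X. X \<in> Obj J \<Longrightarrow> Component s X = Component t X \<odot>\<^bsub>C\<^esub> v X" by metis
  define u where "u = \<lparr>Src = Src s, Tgt = Src t, Component = restrict v (Obj J)\<rparr>"
  have "v Y \<odot>\<^bsub>C\<^esub> AMap (Src s) f = AMap (Src t) f \<odot>\<^bsub>C\<^esub> v X" if f: "f \<in> Hom J X Y" for f X Y
  proof -
    have XY: "X \<in> Obj J" "Y \<in> Obj J" using J.Hom_Obj[OF f] by auto
    have F: "AMap (Src s) f \<in> Hom C (OMap (Src s) X) (OMap (Src s) Y)"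
      and G: "AMap (Src t) f \<in> Hom C (OMap (Src t) X) (OMap (Src t) Y)"
      and H: "AMap (Tgt t) f \<in> Hom C (OMap (Tgt t) X) (OMap (Tgt t) Y)"
      using s t f by (auto intro!: AMap_Hom simp: is_nat_trans_def)
    have "Component t Y \<odot>\<^bsub>C\<^esub> (v Y \<odot>\<^bsub>C\<^esub> AMap (Src s) f) = Component s Y \<odot>\<^bsub>C\<^esub> AMap (Src s) f"
      using C.Comp_assoc[OF F v[OF XY(2)] tH[OF XY(2)]] sv XY by simp
    also have "\<dots> = AMap (Tgt t) f \<odot>\<^bsub>C\<^esub> (Component t X \<odot>\<^bsub>C\<^esub> v X)"
      using naturality[OF s f] tgt sv XY by simp
    also have "\<dots> = Component t Y \<odot>\<^bsub>C\<^esub> AMap (Src t) f \<odot>\<^bsub>C\<^esub> v X"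
      using C.Comp_assoc[OF v[OF XY(1)] tH[OF XY(1)] H] naturality[OF t f] by simp
    also have "\<dots> = Component t Y \<odot>\<^bsub>C\<^esub> (AMap (Src t) f \<odot>\<^bsub>C\<^esub> v X)"
      using C.Comp_assoc[OF v[OF XY(1)] G tH[OF XY(2)]] by simp
    finally show ?thesis
      using monicD[OF m[OF XY(2)]] C.Comp_in_Hom[OF F v[OF XY(2)]] C.Comp_in_Hom[OF v[OF XY(1)] G]
        HomD(2)[OF tH[OF XY(2)]] by metis
  qed
  then have u: "is_nat_trans J C u"
    using s t v J.Hom_Obj unfolding u_def is_nat_trans_def by auto
  have "is_nat_trans J C (t \<odot>\<^bsub>Fun J C\<^esub> u)" by (rule nat_trans_Comp[OF t u]) (simp add: u_def)
  then have "s = t \<odot>\<^bsub>Fun J C\<^esub> u"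
    by (rule nat_trans_eqI[OF s]) (simp_all add: u_def tgt sv)
  then show ?thesis
    using u unfolding factors_through_def by (intro bexI[of _ u]) (simp_all add: Hom_Fun_iff u_def)
qed

lemma factors_through_FunD:
  assumes "factors_through (Fun J C) s t" and X: "X \<in> Obj J" and t: "is_nat_trans J C t"
  shows "factors_through C (Component s X) (Component t X)"
proof -
  obtain u where u: "is_nat_trans J C u" "Src u = Src s" "Tgt u = Src t"
    and s_eq: "s = t \<odot>\<^bsub>Fun J C\<^esub> u"
    using assms(1) unfolding factors_through_def by (auto simp: Hom_Fun_iff)
  have s: "is_nat_trans J C s" using nat_trans_Comp[OF t u(1)] u(3) s_eq by metis
  have "Component s X = Component t X \<odot>\<^bsub>C\<^esub> Component u X"
    by (subst s_eq) (simp add: X)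
  then show ?thesis
    using Component_Hom[OF u(1) X] HomD(2)[OF Component_Hom[OF s X]]
      HomD(2)[OF Component_Hom[OF t X]] u(2,3)
    unfolding factors_through_def by auto
qed

text \<open>The arrows induced between the subobjects are unique because each \<open>m X\<close> is
  monic, so the functor laws follow from those of \<open>F\<close> by cancelling. It serves twice,
  for pointwise kernels and for pointwise joins.\<close>

lemma subfunctor:
  assumes F: "is_functor J C F"
    and m: "\<And>X. X \<in> Obj J \<Longrightarrow> m X \<in> monics_into C (OMap F X)"
    and stable: "\<And>X Y f. f \<in> Hom J X Y \<Longrightarrow> factors_through C (AMap F f \<odot>\<^bsub>C\<^esub> m X) (m Y)"
  obtains t where "is_nat_trans J C t" "Tgt t = F" "\<And>X. X \<in> Obj J \<Longrightarrow> Component t X = m X"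
proof -
  define D where "D X = Dom C (m X)" for X
  have mH: "m X \<in> Hom C (D X) (OMap F X)" if "X \<in> Obj J" for X
    using monics_intoD(4)[OF m[OF that]] by (simp add: D_def)
  have mono: "f = g" if "X \<in> Obj J" "m X \<odot>\<^bsub>C\<^esub> f = m X \<odot>\<^bsub>C\<^esub> g" "f \<in> Hom C W (D X)" "g \<in> Hom C W (D X)"
    for X f g W
    using monicD[OF monics_intoD(1)[OF m[OF that(1)]] that(2)] that(3,4) by (simp add: D_def)
  \<comment> \<open>Stated over arrows with their own domain and codomain, so that the chosen
    \<open>T\<close> depends on \<open>f\<close> alone, as an arrow map must.\<close>
  have "\<exists>u. u \<in> Hom C (D (Dom J f)) (D (Cod J f)) \<and>
      AMap F f \<odot>\<^bsub>C\<^esub> m (Dom J f) = m (Cod J f) \<odot>\<^bsub>C\<^esub> u" if f: "f \<in> Arr J" for f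
  proof -
    have fH: "f \<in> Hom J (Dom J f) (Cod J f)" using f by (simp add: Hom_def)
    have "AMap F f \<odot>\<^bsub>C\<^esub> m (Dom J f) \<in> Hom C (D (Dom J f)) (OMap F (Cod J f))"
      using C.Comp_in_Hom[OF mH AMap_Hom[OF F fH]] J.Dom_closed[OF f] by simp
    then show ?thesis
      using stable[OF fH] HomD(2) unfolding factors_through_def D_def[symmetric] by metis
  qed
  then obtain T where TA: "\<And>f. f \<in> Arr J \<Longrightarrow> T f \<in> Hom C (D (Dom J f)) (D (Cod J f))"
    and TEA: "\<And>f. f \<in> Arr J \<Longrightarrow> AMap F f \<odot>\<^bsub>C\<^esub> m (Dom J f) = m (Cod J f) \<odot>\<^bsub>C\<^esub> T f"
    by metis
  have T: "T f \<in> Hom C (D X) (D Y)" and TE: "AMap F f \<odot>\<^bsub>C\<^esub> m X = m Y \<odot>\<^bsub>C\<^esub> T f"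
    if "f \<in> Hom J X Y" for f X Y
    using TA TEA that by (auto simp: Hom_def)
  define G where "G = \<lparr>OMap = restrict D (Obj J), AMap = restrict T (Arr J)\<rparr>"
  have D: "D X \<in> Obj C" if "X \<in> Obj J" for X using C.Hom_Obj[OF mH[OF that]] by simp
  have Tid: "T (Ident J X) = Ident C (D X)" if X: "X \<in> Obj J" for X
  proof (rule mono[OF X _ T C.Ident_in_Hom])
    show "m X \<odot>\<^bsub>C\<^esub> T (Ident J X) = m X \<odot>\<^bsub>C\<^esub> Ident C (D X)"
      using TE[OF J.Ident_in_Hom[OF X]] AMap_Ident[OF F X] C.Ident_Comp[OF mH[OF X]]
        C.Comp_Ident[OF mH[OF X]] by simp
  qed (use X D J.Ident_in_Hom in auto)
  have Tcomp: "T (g \<odot>\<^bsub>J\<^esub> f) = T g \<odot>\<^bsub>C\<^esub> T f" if f: "f \<in> Hom J X Y" and g: "g \<in> Hom J Y Z" for f g X Y Z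
  proof -
    have O: "X \<in> Obj J" "Y \<in> Obj J" "Z \<in> Obj J" using J.Hom_Obj f g by auto
    note gf = J.Comp_in_Hom[OF f g]
    have "m Z \<odot>\<^bsub>C\<^esub> T (g \<odot>\<^bsub>J\<^esub> f) = AMap F g \<odot>\<^bsub>C\<^esub> AMap F f \<odot>\<^bsub>C\<^esub> m X"
      using TE[OF gf] AMap_Comp[OF F f g] by simp
    also have "\<dots> = AMap F g \<odot>\<^bsub>C\<^esub> (m Y \<odot>\<^bsub>C\<^esub> T f)"
      using C.Comp_assoc[OF mH[OF O(1)] AMap_Hom[OF F f] AMap_Hom[OF F g]] TE[OF f] by simp
    also have "\<dots> = m Z \<odot>\<^bsub>C\<^esub> T g \<odot>\<^bsub>C\<^esub> T f"
      using C.Comp_assoc[OF T[OF f] mH[OF O(2)] AMap_Hom[OF F g]] TE[OF g] by simp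
    also have "\<dots> = m Z \<odot>\<^bsub>C\<^esub> (T g \<odot>\<^bsub>C\<^esub> T f)"
      by (rule C.Comp_assoc[OF T[OF f] T[OF g] mH[OF O(3)]])
    finally show ?thesis by (rule mono[OF O(3) _ T[OF gf] C.Comp_in_Hom[OF T[OF f] T[OF g]]])
  qed
  have Jcl: "g \<odot>\<^bsub>J\<^esub> f \<in> Arr J" if "f \<in> Hom J X Y" "g \<in> Hom J Y Z" for f g X Y Z
    using HomD(1)[OF J.Comp_in_Hom[OF that]] .
  have "is_functor J C G"
    unfolding is_functor_def
  proof (intro conjI ballI allI)
    show "OMap G \<in> Obj J \<rightarrow>\<^sub>E Obj C" using D by (simp add: G_def)
    show "AMap G \<in> Arr J \<rightarrow>\<^sub>E Arr C" using HomD(1)[OF TA] by (simp add: G_def)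
    show "AMap G f \<in> Hom C (OMap G (Dom J f)) (OMap G (Cod J f))" if "f \<in> Arr J" for f
      using TA[OF that] J.Dom_closed[OF that] J.Cod_closed[OF that] that by (simp add: G_def)
    show "AMap G (Ident J X) = Ident C (OMap G X)" if "X \<in> Obj J" for X
      using Tid[OF that] HomD(1)[OF J.Ident_in_Hom[OF that]] that by (simp add: G_def)
    show "AMap G (g \<odot>\<^bsub>J\<^esub> f) = AMap G g \<odot>\<^bsub>C\<^esub> AMap G f"
      if "f \<in> Hom J X Y" "g \<in> Hom J Y Z" for X Y Z f g
      using Tcomp[OF that] Jcl[OF that] HomD(1)[OF that(1)] HomD(1)[OF that(2)]
      by (simp add: G_def)
  qed
  then have "is_nat_trans J C \<lparr>Src = G, Tgt = F, Component = restrict m (Obj J)\<rparr>"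
    using F mH TE J.Hom_Obj HomD(1) by (fastforce simp: is_nat_trans_def G_def)
  then show thesis by (rule that) auto
qed

end


section \<open>Kernels\<close>

context preadditive_category
begin

lemma Zero_in_Hom: "\<lbrakk>X \<in> Obj C; Y \<in> Obj C\<rbrakk> \<Longrightarrow> Zero C X Y \<in> Hom C X Y"
  using monoid.one_closed[OF group.axioms(1)[OF comm_group.axioms(2)[OF hom_comm_group]]]
  by (simp add: hom_group_def)

text \<open>The identity is the only idempotent of a group. With distributivity of composition this
  yields \<open>Comp_Zero\<close> and \<open>Zero_Comp\<close>.\<close>

lemma Add_self_eq_Zero:
  assumes f: "f \<in> Hom C X Y" and "f \<boxplus> f = f"
  shows "f = Zero C X Y"
proof -
  interpret group "hom_group C X Y"
    using hom_comm_group[OF Hom_Obj[OF f]] by (rule comm_group.axioms(2))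
  show ?thesis using r_cancel_one[of f f] assms by (simp add: hom_group_def)
qed

lemma Comp_Zero:
  assumes "X \<in> Obj C" "g \<in> Hom C Y Z"
  shows "g \<odot> Zero C X Y = Zero C X Z"
proof (rule Add_self_eq_Zero)
  have Y: "Y \<in> Obj C" using Hom_Obj assms(2) by blast
  interpret group "hom_group C X Y"
    using hom_comm_group[OF assms(1) Y] by (rule comm_group.axioms(2))
  have "Zero C X Y \<boxplus> Zero C X Y = Zero C X Y"
    using l_one[OF one_closed] by (simp add: hom_group_def)
  then show "g \<odot> Zero C X Y \<boxplus> g \<odot> Zero C X Y = g \<odot> Zero C X Y"
    using Comp_Add Zero_in_Hom[OF assms(1) Y] assms(2) by metis
  show "g \<odot> Zero C X Y \<in> Hom C X Z"
    by (rule Comp_in_Hom[OF Zero_in_Hom[OF assms(1) Y] assms(2)])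
qed

lemma Zero_Comp:
  assumes "f \<in> Hom C X Y" "Z \<in> Obj C"
  shows "Zero C Y Z \<odot> f = Zero C X Z"
proof (rule Add_self_eq_Zero)
  have Y: "Y \<in> Obj C" using Hom_Obj assms(1) by blast
  interpret group "hom_group C Y Z"
    using hom_comm_group[OF Y assms(2)] by (rule comm_group.axioms(2))
  have "Zero C Y Z \<boxplus> Zero C Y Z = Zero C Y Z"
    using l_one[OF one_closed] by (simp add: hom_group_def)
  then show "Zero C Y Z \<odot> f \<boxplus> Zero C Y Z \<odot> f = Zero C Y Z \<odot> f"
    using Add_Comp Zero_in_Hom[OF Y assms(2)] assms(1) by metis
  show "Zero C Y Z \<odot> f \<in> Hom C X Z"
    by (rule Comp_in_Hom[OF assms(1) Zero_in_Hom[OF Y assms(2)]])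
qed

text \<open>If \<open>m\<close> equalizes \<open>f\<close> and \<open>g\<close>, it kills their
  difference. In the proof \<open>g'\<close> is the additive inverse of \<open>g\<close>, so
  \<open>f \<boxplus> g'\<close> plays the role of that difference.\<close>

lemma monic_if_trivial_kernel:
  assumes m: "m \<in> Hom C K X"
    and ker: "\<And>W h. \<lbrakk>h \<in> Hom C W K; m \<odot> h = Zero C W X\<rbrakk> \<Longrightarrow> h = Zero C W K"
  shows "monic C m"
  unfolding monic_def
proof (intro conjI allI ballI impI)
  show "m \<in> Arr C" using m by (rule HomD)
  fix W f g
  assume "f \<in> Hom C W (Dom C m)" "g \<in> Hom C W (Dom C m)" and eq: "m \<odot> f = m \<odot> g"
  then have f: "f \<in> Hom C W K" and g: "g \<in> Hom C W K" using HomD(2)[OF m] by auto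
  interpret group "hom_group C W K"
    using hom_comm_group[OF Hom_Obj[OF f]] by (rule comm_group.axioms(2))
  have W: "W \<in> Obj C" using Hom_Obj[OF f] by simp
  obtain g' where g': "g' \<in> Hom C W K" "g \<boxplus> g' = Zero C W K"
    using r_inv_ex[of g] g by (auto simp: hom_group_def)
  have "m \<odot> (f \<boxplus> g') = m \<odot> (g \<boxplus> g')" using Comp_Add f g g'(1) m eq by metis
  then have "m \<odot> (f \<boxplus> g') = Zero C W X" using g'(2) Comp_Zero[OF W m] by simp
  then have "f \<boxplus> g' = g \<boxplus> g'"
    using ker[of "f \<boxplus> g'" W] m_closed[of f g'] f g' by (simp add: hom_group_def)
  then show "f = g" using right_cancel[of g' f g] f g g' by (simp add: hom_group_def)
qed

lemma is_kernelD:
  assumes "is_kernel C f k" "f \<in> Hom C X Y"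
  shows "k \<in> Hom C (Dom C k) X" "f \<odot> k = Zero C (Dom C k) Y"
    and "\<lbrakk>h \<in> Hom C W X; f \<odot> h = Zero C W Y\<rbrakk> \<Longrightarrow> factors_through C h k"
proof -
  note X = HomD(2,3)[OF assms(2)]
  show "k \<in> Hom C (Dom C k) X" "f \<odot> k = Zero C (Dom C k) Y"
    using assms(1) X by (auto simp: is_kernel_def Hom_def)
  assume h: "h \<in> Hom C W X" and "f \<odot> h = Zero C W Y"
  then have "\<exists>!u. u \<in> Hom C W (Dom C k) \<and> k \<odot> u = h"
    using assms(1) X unfolding is_kernel_def by blast
  then show "factors_through C h k"
    using HomD(2)[OF h] unfolding factors_through_def by blast
qed

text \<open>This is the uniqueness half of the universal property: if
  \<open>k \<odot> u = k \<odot> v\<close>, then \<open>u\<close> and \<open>v\<close> are two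
  factorizations of one arrow killed by \<open>f\<close>.\<close>

lemma kernel_monic:
  assumes k: "is_kernel C f k" and f: "f \<in> Hom C X Y"
  shows "k \<in> monics_into C X"
proof -
  note kH = is_kernelD(1)[OF k f]
  have "monic C k"
    unfolding monic_def
  proof (intro conjI allI ballI impI)
    show "k \<in> Arr C" using kH by (rule HomD)
    fix W u v
    assume uv: "u \<in> Hom C W (Dom C k)" "v \<in> Hom C W (Dom C k)" and eq: "k \<odot> u = k \<odot> v"
    have "f \<odot> (k \<odot> u) = f \<odot> k \<odot> u" by (rule Comp_assoc[OF uv(1) kH f, symmetric])
    also have "\<dots> = Zero C W Y"
      unfolding is_kernelD(2)[OF k f] by (rule Zero_Comp[OF uv(1) Hom_Obj(2)[OF f]])
    finally have 0: "f \<odot> (k \<odot> u) = Zero C W Y" .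
    have "\<forall>W. \<forall>h \<in> Hom C W X. f \<odot> h = Zero C W Y \<longrightarrow>
        (\<exists>!w. w \<in> Hom C W (Dom C k) \<and> k \<odot> w = h)"
      using k HomD(2,3)[OF f] by (simp add: is_kernel_def)
    from this[rule_format, OF Comp_in_Hom[OF uv(1) kH] 0]
    obtain w where "\<And>w'. w' \<in> Hom C W (Dom C k) \<and> k \<odot> w' = k \<odot> u \<Longrightarrow> w' = w"
      by (elim ex1E) iprover
    from this[of u] this[of v] show "u = v" using uv eq by simp
  qed
  then show ?thesis using HomD(3)[OF kH] by (simp add: monics_into_def)
qed

end

text \<open>A monomorphism is a kernel, so it is determined by the arrows that annihilate it.\<close>

lemma (in abelian_category) factors_through_if_annihilated:
  assumes n: "n \<in> monics_into C X" and m: "m \<in> Hom C W X"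
    and ann: "\<And>Y g. \<lbrakk>g \<in> Hom C X Y; g \<odot> n = Zero C (Dom C n) Y\<rbrakk> \<Longrightarrow> g \<odot> m = Zero C W Y"
  shows "factors_through C m n"
proof -
  obtain g where g: "g \<in> Arr C" "is_kernel C g n"
    using monic_is_kernel monics_intoD(1)[OF n] by blast
  have gH: "g \<in> Hom C X (Cod C g)"
    using g monics_intoD(2)[OF n] by (auto simp: is_kernel_def Hom_def)
  show ?thesis
    by (rule is_kernelD(3)[OF g(2) gH m ann[OF gH is_kernelD(2)[OF g(2) gH]]])
qed

section \<open>Monomorphisms of functors into an abelian category\<close>

locale functors_to_abelian = J: category J + C: abelian_category C
  for J :: "('i, 'j, 'n) cat_scheme" and C :: "('o, 'a, 'm) preadd_cat_scheme"

sublocale functors_to_abelian \<subseteq> two_categories ..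

context functors_to_abelian
begin

text \<open>The pointwise kernels of \<open>t\<close> form a subfunctor of its source, whose inclusion is
  equalized with the zero transformation by \<open>t\<close>.\<close>

lemma monic_Component:
  assumes mono: "monic (Fun J C) t" and X: "X \<in> Obj J"
  shows "monic C (Component t X)"
proof -
  have t: "is_nat_trans J C t" using mono by (simp add: monic_def)
  then have S: "is_functor J C (Src t)" and T: "is_functor J C (Tgt t)"
    by (auto simp: is_nat_trans_def)
  note tH = Component_Hom[OF t]
  have "\<exists>k. is_kernel C (Component t x) k" if "x \<in> Obj J" for x
    using C.kernel_exists HomD(1)[OF tH[OF that]] by blast
  then obtain k where k: "\<And>x. x \<in> Obj J \<Longrightarrow> is_kernel C (Component t x) (k x)" by metis
  have kH: "k x \<in> Hom C (Dom C (k x)) (OMap (Src t) x)"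
    and k0: "Component t x \<odot>\<^bsub>C\<^esub> k x = Zero C (Dom C (k x)) (OMap (Tgt t) x)"
    and km: "k x \<in> monics_into C (OMap (Src t) x)"
    if "x \<in> Obj J" for x
    using C.is_kernelD(1,2)[OF k tH] C.kernel_monic[OF k tH] that by auto
  have "factors_through C (AMap (Src t) f \<odot>\<^bsub>C\<^esub> k x) (k y)" if f: "f \<in> Hom J x y" for f x y
  proof (rule C.is_kernelD(3)[OF k tH])
    have xy: "x \<in> Obj J" "y \<in> Obj J" using J.Hom_Obj[OF f] by auto
    note Sf = AMap_Hom[OF S f] and Tf = AMap_Hom[OF T f] and D = C.Hom_Obj(1)[OF kH[OF xy(1)]]
    show "AMap (Src t) f \<odot>\<^bsub>C\<^esub> k x \<in> Hom C (Dom C (k x)) (OMap (Src t) y)"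
      by (rule C.Comp_in_Hom[OF kH[OF xy(1)] Sf])
    \<comment> \<open>Naturality moves \<open>t\<close> to the right, where it meets its kernel at
      \<open>x\<close>. So the source functor carries kernels into kernels.\<close>
    have "Component t y \<odot>\<^bsub>C\<^esub> (AMap (Src t) f \<odot>\<^bsub>C\<^esub> k x)
        = AMap (Tgt t) f \<odot>\<^bsub>C\<^esub> Component t x \<odot>\<^bsub>C\<^esub> k x"
      using C.Comp_assoc[OF kH[OF xy(1)] Sf tH[OF xy(2)]] naturality[OF t f] by simp
    also have "\<dots> = Zero C (Dom C (k x)) (OMap (Tgt t) y)"
      using C.Comp_assoc[OF kH[OF xy(1)] tH[OF xy(1)] Tf] k0[OF xy(1)] C.Comp_Zero[OF D Tf] by simp
    finally show "Component t y \<odot>\<^bsub>C\<^esub> (AMap (Src t) f \<odot>\<^bsub>C\<^esub> k x) = Zero C (Dom C (k x)) (OMap (Tgt t) y)" .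
    show "y \<in> Obj J" "y \<in> Obj J" by (fact xy)+
  qed
  then obtain s where s: "is_nat_trans J C s" "Tgt s = Src t"
    and sk: "\<And>x. x \<in> Obj J \<Longrightarrow> Component s x = k x"
    using subfunctor[OF S km] by blast
  \<comment> \<open>The zero transformation parallel to \<open>s\<close>: only the components are
    replaced, so source and target agree and \<open>t\<close> can be cancelled.\<close>
  define z where "z = s\<lparr>Component := \<lambda>x\<in>Obj J. Zero C (OMap (Src s) x) (OMap (Tgt s) x)\<rparr>"
  have Fs: "is_functor J C (Src s)" "is_functor J C (Tgt s)" using s(1) by (auto simp: is_nat_trans_def)
  have "Zero C (OMap (Src s) y) (OMap (Tgt s) y) \<odot>\<^bsub>C\<^esub> AMap (Src s) f
      = AMap (Tgt s) f \<odot>\<^bsub>C\<^esub> Zero C (OMap (Src s) x) (OMap (Tgt s) x)" if f: "f \<in> Hom J x y" for f x y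
    using C.Zero_Comp[OF AMap_Hom[OF Fs(1) f] OMap_Obj[OF Fs(2) J.Hom_Obj(2)[OF f]]]
      C.Comp_Zero[OF OMap_Obj[OF Fs(1) J.Hom_Obj(1)[OF f]] AMap_Hom[OF Fs(2) f]] by simp
  then have z: "is_nat_trans J C z"
    using Fs J.Hom_Obj C.Zero_in_Hom OMap_Obj[OF Fs(1)] OMap_Obj[OF Fs(2)]
    by (auto simp: is_nat_trans_def z_def)
  have Dk: "Dom C (k x) = OMap (Src s) x" if "x \<in> Obj J" for x
    using HomD(2)[OF Component_Hom[OF s(1) that]] sk[OF that] by simp
  have "Component t x \<odot>\<^bsub>C\<^esub> Component s x = Component t x \<odot>\<^bsub>C\<^esub> Component z x" if x: "x \<in> Obj J" for x
    using k0[OF x] sk[OF x] Dk[OF x] C.Comp_Zero[OF OMap_Obj[OF Fs(1) x] tH[OF x]] x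
    by (simp add: z_def s(2))
  then have "t \<odot>\<^bsub>Fun J C\<^esub> s = t \<odot>\<^bsub>Fun J C\<^esub> z"
    by (auto simp: z_def fun_eq_iff restrict_def)
  then have "s = z"
    using monicD[OF mono, of s z "Src s"] s z by (simp add: Hom_Fun_iff z_def)
  then have "k X = Component z X" using sk[OF X] by simp
  \<comment> \<open>The kernel inclusion at \<open>X\<close> is now zero. Whatever
    \<open>Component t X\<close> kills factors through it, hence is zero too.\<close>
  then have kz: "k X = Zero C (Dom C (k X)) (OMap (Src t) X)"
    using Dk[OF X] s(2) X by (simp add: z_def)
  show ?thesis
  proof (rule C.monic_if_trivial_kernel[OF tH[OF X]])
    fix W h
    assume h: "h \<in> Hom C W (OMap (Src t) X)" "Component t X \<odot>\<^bsub>C\<^esub> h = Zero C W (OMap (Tgt t) X)"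
    then obtain u where u: "u \<in> Hom C W (Dom C (k X))" "h = k X \<odot>\<^bsub>C\<^esub> u"
      using C.is_kernelD(3)[OF k[OF X] tH[OF X]] HomD(2)[OF h(1)] unfolding factors_through_def by blast
    show "h = Zero C W (OMap (Src t) X)"
      unfolding u(2) by (subst kz) (rule C.Zero_Comp[OF u(1) OMap_Obj[OF S X]])
  qed
qed

text \<open>Connects the two levels: preradicals are monic in the functor category, while joins are
  built from subobjects at each object.\<close>

lemma monic_Fun_iff:
  "monic (Fun J C) t \<longleftrightarrow> is_nat_trans J C t \<and> (\<forall>X \<in> Obj J. monic C (Component t X))"
  using monic_Component[of t] monic_FunI[of t] monic_def[of "Fun J C" t] by auto

end


section \<open>Joins of subobjects\<close>

context abelian_category
begin

text \<open>Larger subobjects have fewer annihilators. Together with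
  \<open>factors_through_if_annihilated\<close>, this translates comparisons of subobjects into
  comparisons of annihilators.\<close>

lemma annihilate_if_factors_through:
  assumes "factors_through C m n" "n \<in> Hom C W X" "g \<in> Hom C X Y" "g \<odot> n = Zero C W Y"
  shows "g \<odot> m = Zero C (Dom C m) Y"
proof -
  obtain u where u: "u \<in> Hom C (Dom C m) W" "m = n \<odot> u"
    using assms(1) HomD(2)[OF assms(2)] unfolding factors_through_def by blast
  have "g \<odot> m = g \<odot> n \<odot> u"
    unfolding u(2) by (rule Comp_assoc[OF u(1) assms(2,3), symmetric])
  then show ?thesis using assms(4) Zero_Comp[OF u(1) Hom_Obj(2)[OF assms(3)]] by simp
qed

text \<open>The join is the image of the coproduct. As \<open>C\<close> has few subobjects of \<open>X\<close>, the coproduct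
  can be taken over one representative of each class; the image is the kernel of the cokernel.\<close>

lemma join_of_monics:
  assumes cocomplete: "cocomplete_cat TYPE('u) C" and small: "locally_small TYPE('u) C"
    and X: "X \<in> Obj C" and M: "M \<subseteq> monics_into C X"
  obtains t where "t \<in> monics_into C X" "\<And>m. m \<in> M \<Longrightarrow> factors_through C m t"
    "\<And>Y g. \<lbrakk>g \<in> Hom C X Y; \<And>m. m \<in> M \<Longrightarrow> g \<odot> m = Zero C (Dom C m) Y\<rbrakk>
       \<Longrightarrow> g \<odot> t = Zero C (Dom C t) Y"
proof -
  define cls where "cls m = subobject_rel C X `` {m}" for m
  define B where "B = cls ` M"
  \<comment> \<open>\<open>M\<close> itself carries no size bound; only the set \<open>B\<close> of
    its classes is small.\<close>
  have "B \<subseteq> Sub C X" using M Sub_class by (auto simp: B_def cls_def)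
  then have B: "B \<prec> (UNIV :: 'u set)"
    using lesspoll_trans1[OF subset_imp_lepoll] small X
    unfolding locally_small_def small_def by blast
  \<comment> \<open>Cocompleteness speaks of diagrams whose shape lives in \<open>'u\<close>, so the
    classes are renamed by elements of \<open>'u\<close>.\<close>
  then obtain h :: "'a set \<Rightarrow> 'u" where h: "inj_on h B"
    using lesspoll_imp_lepoll unfolding lepoll_def by blast
  define N where "N = h ` B"
  have N: "N \<prec> (UNIV :: 'u set)"
    unfolding N_def by (rule lesspoll_trans1[OF image_lepoll B])
  define r where "r b = (SOME m. m \<in> M \<and> cls m = b)" for b
  have r: "r b \<in> M" "cls (r b) = b" if "b \<in> B" for b
  proof -
    have "\<exists>m. m \<in> M \<and> cls m = b" using that by (auto simp: B_def)
    from someI_ex[OF this] show "r b \<in> M" "cls (r b) = b" by (simp_all add: r_def)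
  qed
  define d where "d j = r (inv_into B h j)" for j
  have dM: "d j \<in> M" if "j \<in> N" for j
    unfolding d_def by (rule r(1)[OF inv_into_into]) (use that in \<open>simp add: N_def\<close>)
  have dH: "d j \<in> Hom C (Dom C (d j)) X" if "j \<in> N" for j
    by (rule monics_intoD(4)[OF subsetD[OF M dM[OF that]]])
  note dO = Hom_Obj(1)[OF dH]
  \<comment> \<open>The chosen \<open>d j\<close> suffice: each \<open>m\<close> is equivalent to
    the representative of its own class.\<close>
  have rep: "\<exists>j \<in> N. factors_through C m (d j)" if m: "m \<in> M" for m
  proof -
    have b: "cls m \<in> B" using m by (simp add: B_def)
    then have "d (h (cls m)) = r (cls m)" using h by (simp add: d_def)
    moreover have "n \<in> cls m \<Longrightarrow> factors_through C m n" for n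
      by (simp add: cls_def subobject_rel_def)
    moreover have "r (cls m) \<in> cls m"
      using r(2)[OF b] class_self[OF subsetD[OF M r(1)[OF b]]] by (simp add: cls_def)
    ultimately have "factors_through C m (d (h (cls m)))" by simp
    then show ?thesis using b by (auto simp: N_def)
  qed
  \<comment> \<open>The discrete category on \<open>N\<close>, each object being its own identity
    arrow. Composable arrows coincide, so returning the first argument is a correct
    composition.\<close>
  define J :: "('u, 'u) cat" where
    "J = \<lparr>Obj = N, Arr = N, Dom = \<lambda>j. j, Cod = \<lambda>j. j, Ident = \<lambda>j. j, Comp = \<lambda>j k. j\<rparr>"
  define F where
    "F = \<lparr>OMap = \<lambda>j\<in>N. Dom C (d j), AMap = \<lambda>j\<in>N. Ident C (Dom C (d j))\<rparr>"
  have J_simps: "Obj J = N" "Arr J = N" "Dom J j = j" "Cod J j = j" "Ident J j = j"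
    "k \<odot>\<^bsub>J\<^esub> j = k" for j k
    by (simp_all add: J_def)
  have HomJ: "k \<in> Hom J i j \<longleftrightarrow> k \<in> N \<and> i = k \<and> j = k" for i j k
    by (auto simp: Hom_def J_simps)
  have "category J" by unfold_locales (auto simp: HomJ J_simps)
  moreover have "is_functor J C F"
    using dO Ident_in_Hom[OF dO] HomD(1)[OF Ident_in_Hom[OF dO]] Comp_Ident[OF Ident_in_Hom[OF dO]]
    by (auto simp: is_functor_def F_def HomJ J_simps)
  moreover have "Obj J \<prec> (UNIV :: 'u set)" "Arr J \<prec> (UNIV :: 'u set)"
    using N by (simp_all add: J_simps)
  ultimately obtain K p where col: "is_colimit J C F K p"
    using cocomplete unfolding cocomplete_cat_def small_def by blast
  have cocone: "is_cocone J C F Y q"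
    if "Y \<in> Obj C" "\<And>j. j \<in> N \<Longrightarrow> q j \<in> Hom C (Dom C (d j)) Y" for Y q
    using that Comp_Ident[OF that(2)] by (simp add: is_cocone_def J_simps F_def)
  have univ: "\<exists>!u. u \<in> Hom C K Y \<and> (\<forall>j \<in> N. u \<odot> p j = q j)"
    if "Y \<in> Obj C" "\<And>j. j \<in> N \<Longrightarrow> q j \<in> Hom C (Dom C (d j)) Y" for Y q
    using col cocone[OF that] by (simp add: is_colimit_def J_simps)
  have K: "K \<in> Obj C" and pH: "\<And>j. j \<in> N \<Longrightarrow> p j \<in> Hom C (Dom C (d j)) K"
    using col by (simp_all add: is_colimit_def is_cocone_def J_simps F_def)
  obtain u where u: "u \<in> Hom C K X" and up: "\<And>j. j \<in> N \<Longrightarrow> u \<odot> p j = d j"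
    using univ[OF X, of d] dH by blast
  obtain c where c: "is_cokernel C u c" using cokernel_exists HomD(1)[OF u] by blast
  define Q where "Q = Cod C c"
  have cH: "c \<in> Hom C X Q" and cu: "c \<odot> u = Zero C K Q"
    using c HomD(2,3)[OF u] by (auto simp: is_cokernel_def Q_def Hom_def)
  have cuniv: "\<exists>!v. v \<in> Hom C Q Y \<and> v \<odot> c = g" if "g \<in> Hom C X Y" "g \<odot> u = Zero C K Y" for g Y
    using c HomD(2,3)[OF u] that by (simp add: is_cokernel_def Q_def)
  obtain t where t: "is_kernel C c t" using kernel_exists HomD(1)[OF cH] by blast
  note tM = kernel_monic[OF t cH] and tH = is_kernelD(1)[OF t cH]
  show thesis
  proof (rule that[OF tM])
    fix m assume "m \<in> M"
    then obtain j where j: "j \<in> N" "factors_through C m (d j)" using rep by blast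
    have "c \<odot> d j = c \<odot> u \<odot> p j"
      unfolding up[OF j(1), symmetric] by (rule Comp_assoc[OF pH[OF j(1)] u cH, symmetric])
    also have "\<dots> = Zero C (Dom C (d j)) Q"
      unfolding cu by (rule Zero_Comp[OF pH[OF j(1)] Hom_Obj(2)[OF cH]])
    finally have "factors_through C (d j) t"
      using is_kernelD(3)[OF t cH dH[OF j(1)]] by simp
    then show "factors_through C m t"
      using factors_through_trans[OF j(2)] HomD(1)[OF tH] by blast
  next
    fix Y g
    assume g: "g \<in> Hom C X Y" and g0: "\<And>m. m \<in> M \<Longrightarrow> g \<odot> m = Zero C (Dom C m) Y"
    note Y = Hom_Obj(2)[OF g]
    have "g \<odot> u \<odot> p j = Zero C (Dom C (d j)) Y" if "j \<in> N" for j
      using Comp_assoc[OF pH[OF that] u g] up[OF that] g0[OF dM[OF that]] by simp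
    moreover have "Zero C K Y \<odot> p j = Zero C (Dom C (d j)) Y" if "j \<in> N" for j
      by (rule Zero_Comp[OF pH[OF that] Y])
    \<comment> \<open>Both arrows mediate the zero cocone, so uniqueness in the colimit identifies
      them.\<close>
    ultimately have "g \<odot> u = Zero C K Y"
      using univ[OF Y, of "\<lambda>j. Zero C (Dom C (d j)) Y"] Zero_in_Hom[OF dO Y]
        Comp_in_Hom[OF u g] Zero_in_Hom[OF K Y] by blast
    \<comment> \<open>As \<open>g\<close> kills \<open>u\<close>, it factors through the cokernel
      \<open>c\<close>, and \<open>c\<close> kills its kernel \<open>t\<close>.\<close>
    then obtain v where v: "v \<in> Hom C Q Y" "v \<odot> c = g" using cuniv[OF g] by blast
    have "g \<odot> t = v \<odot> (c \<odot> t)"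
      unfolding v(2)[symmetric] by (rule Comp_assoc[OF tH cH v(1)])
    then show "g \<odot> t = Zero C (Dom C t) Y"
      using is_kernelD(2)[OF t cH] Comp_Zero[OF Hom_Obj(1)[OF tH] v(1)] by simp
  qed
qed

end

text \<open>At each object \<open>join_of_monics\<close> applies to the components of
  \<open>S\<close>, and stability under arrows lets \<open>subfunctor\<close> assemble the results.
  \<open>S\<close> may be a proper class.\<close>

lemma (in functors_to_abelian) join_in_Fun:
  assumes cocomplete: "cocomplete_cat TYPE('u) C" and small: "locally_small TYPE('u) C"
    and F: "is_functor J C F" and S: "S \<subseteq> monics_into (Fun J C) F"
  obtains t where "t \<in> monics_into (Fun J C) F" "\<And>s. s \<in> S \<Longrightarrow> factors_through (Fun J C) s t"
    "\<And>n. \<lbrakk>n \<in> monics_into (Fun J C) F; \<And>s. s \<in> S \<Longrightarrow> factors_through (Fun J C) s n\<rbrakk>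
       \<Longrightarrow> factors_through (Fun J C) t n"
proof -
  have ntS: "is_nat_trans J C s" "Tgt s = F" if "s \<in> monics_into (Fun J C) F" for s
    using that by (simp_all add: monics_into_def monic_Fun_iff)
  have comp: "Component s X \<in> monics_into C (OMap F X)"
    if s: "s \<in> monics_into (Fun J C) F" and X: "X \<in> Obj J" for s X
    using HomD(3)[OF Component_Hom[OF ntS(1)[OF s] X]] ntS(2)[OF s] s X
    by (simp add: monics_into_def monic_Fun_iff)
  define Mem where "Mem X = (\<lambda>s. Component s X) ` S" for X
  have Mem: "Mem X \<subseteq> monics_into C (OMap F X)" if "X \<in> Obj J" for X
    unfolding Mem_def using comp[OF subsetD[OF S] that] by (rule image_subsetI)
  \<comment> \<open>Leastness is recorded through annihilators, the form that serves both stability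
    under arrows and comparison with other upper bounds.\<close>
  define is_join where "is_join X t \<longleftrightarrow> t \<in> monics_into C (OMap F X) \<and>
      (\<forall>m \<in> Mem X. factors_through C m t) \<and>
      (\<forall>Y g. g \<in> Hom C (OMap F X) Y \<longrightarrow> (\<forall>m \<in> Mem X. g \<odot>\<^bsub>C\<^esub> m = Zero C (Dom C m) Y) \<longrightarrow>
         g \<odot>\<^bsub>C\<^esub> t = Zero C (Dom C t) Y)" for X t
  define m where "m X = (SOME t. is_join X t)" for X
  have "is_join X (m X)" if X: "X \<in> Obj J" for X
  proof (rule C.join_of_monics[OF cocomplete small OMap_Obj[OF F X] Mem[OF X]])
    fix t
    assume "t \<in> monics_into C (OMap F X)" "\<And>m. m \<in> Mem X \<Longrightarrow> factors_through C m t"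
      "\<And>Y g. \<lbrakk>g \<in> Hom C (OMap F X) Y; \<And>m. m \<in> Mem X \<Longrightarrow> g \<odot>\<^bsub>C\<^esub> m = Zero C (Dom C m) Y\<rbrakk>
         \<Longrightarrow> g \<odot>\<^bsub>C\<^esub> t = Zero C (Dom C t) Y"
    then have "is_join X t" by (simp add: is_join_def)
    then show "is_join X (m X)" unfolding m_def by (rule someI)
  qed
  then have m: "m X \<in> monics_into C (OMap F X)"
    and upper: "\<And>s. s \<in> S \<Longrightarrow> factors_through C (Component s X) (m X)"
    and ann: "\<And>Y g. \<lbrakk>g \<in> Hom C (OMap F X) Y;
        \<And>s. s \<in> S \<Longrightarrow> g \<odot>\<^bsub>C\<^esub> Component s X = Zero C (Dom C (Component s X)) Y\<rbrakk>
        \<Longrightarrow> g \<odot>\<^bsub>C\<^esub> m X = Zero C (Dom C (m X)) Y"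
    if "X \<in> Obj J" for X
    using that by (simp_all add: is_join_def Mem_def)
  note mH = monics_intoD(4)[OF m]
  have "factors_through C (AMap F f \<odot>\<^bsub>C\<^esub> m X) (m Y)" if f: "f \<in> Hom J X Y" for f X Y
  proof -
    have XY: "X \<in> Obj J" "Y \<in> Obj J" using J.Hom_Obj[OF f] by auto
    note Ff = AMap_Hom[OF F f]
    show ?thesis
    proof (rule C.factors_through_if_annihilated[OF m[OF XY(2)] C.Comp_in_Hom[OF mH[OF XY(1)] Ff]])
      fix Z g
      assume g: "g \<in> Hom C (OMap F Y) Z" and g0: "g \<odot>\<^bsub>C\<^esub> m Y = Zero C (Dom C (m Y)) Z"
      have "g \<odot>\<^bsub>C\<^esub> AMap F f \<odot>\<^bsub>C\<^esub> Component s X = Zero C (Dom C (Component s X)) Z" if s: "s \<in> S" for s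
      proof -
        have sM: "s \<in> monics_into (Fun J C) F" using S s by blast
        note snt = ntS[OF sM]
        note sX = monics_intoD(4)[OF comp[OF sM XY(1)]] and sY = monics_intoD(4)[OF comp[OF sM XY(2)]]
        \<comment> \<open>Restricting \<open>F f\<close> to the subfunctor lets naturality of
          \<open>s\<close> bring \<open>Component s Y\<close> next to \<open>g\<close>, which kills
          it.\<close>
        have Sf: "AMap (Src s) f \<in> Hom C (Dom C (Component s X)) (Dom C (Component s Y))"
          using AMap_Hom[OF _ f, of C "Src s"] Component_Hom[OF snt(1)] XY HomD(2) snt(1)
          unfolding is_nat_trans_def by metis
        have "g \<odot>\<^bsub>C\<^esub> AMap F f \<odot>\<^bsub>C\<^esub> Component s X = g \<odot>\<^bsub>C\<^esub> (Component s Y \<odot>\<^bsub>C\<^esub> AMap (Src s) f)"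
          using C.Comp_assoc[OF sX Ff g] naturality[OF snt(1) f] snt(2) by simp
        also have "\<dots> = g \<odot>\<^bsub>C\<^esub> Component s Y \<odot>\<^bsub>C\<^esub> AMap (Src s) f"
          by (rule C.Comp_assoc[OF Sf sY g, symmetric])
        also have "\<dots> = Zero C (Dom C (Component s X)) Z"
          unfolding C.annihilate_if_factors_through[OF upper[OF XY(2) s] mH[OF XY(2)] g g0]
          by (rule C.Zero_Comp[OF Sf C.Hom_Obj(2)[OF g]])
        finally show ?thesis .
      qed
      then have "g \<odot>\<^bsub>C\<^esub> AMap F f \<odot>\<^bsub>C\<^esub> m X = Zero C (Dom C (m X)) Z"
        using ann[OF XY(1) C.Comp_in_Hom[OF Ff g]] by blast
      then show "g \<odot>\<^bsub>C\<^esub> (AMap F f \<odot>\<^bsub>C\<^esub> m X) = Zero C (Dom C (m X)) Z"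
        using C.Comp_assoc[OF mH[OF XY(1)] Ff g] by simp
    qed
  qed
  then obtain t where t: "is_nat_trans J C t" "Tgt t = F"
    and tm: "\<And>X. X \<in> Obj J \<Longrightarrow> Component t X = m X"
    using subfunctor[OF F m] by blast
  show thesis
  proof (rule that[of t])
    show "t \<in> monics_into (Fun J C) F"
      using t tm monics_intoD(1)[OF m] by (simp add: monics_into_def monic_Fun_iff)
    show "factors_through (Fun J C) s t" if "s \<in> S" for s
      using factors_through_FunI[of s t] ntS[of s] S that t tm monics_intoD(1)[OF m] upper
      by (simp add: subset_iff)
    show "factors_through (Fun J C) t n"
      if n: "n \<in> monics_into (Fun J C) F"
        and le: "\<And>s. s \<in> S \<Longrightarrow> factors_through (Fun J C) s n" for n
    proof (rule factors_through_FunI[OF t(1)])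
      show nt: "is_nat_trans J C n" and "Tgt t = Tgt n" using ntS[OF n] t(2) by auto
      fix X assume X: "X \<in> Obj J"
      note nX = comp[OF n X]
      show "monic C (Component n X)" using monics_intoD(1)[OF nX] .
      show "factors_through C (Component t X) (Component n X)"
        unfolding tm[OF X]
      proof (rule C.factors_through_if_annihilated[OF nX mH[OF X]])
        fix Y g
        assume g: "g \<in> Hom C (OMap F X) Y"
          and g0: "g \<odot>\<^bsub>C\<^esub> Component n X = Zero C (Dom C (Component n X)) Y"
        show "g \<odot>\<^bsub>C\<^esub> m X = Zero C (Dom C (m X)) Y"
          using C.annihilate_if_factors_through[OF factors_through_FunD[OF le X nt]
            monics_intoD(4)[OF nX] g g0] ann[OF X g] by blast
      qed
    qed
  qed
qed


section \<open>Preradicals\<close>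

lemma comp_functor_is_functor:
  assumes F: "is_functor B J F" and G: "is_functor J C G" and B: "category B"
  shows "is_functor B C (comp_functor B G F)"
  unfolding is_functor_def
proof (intro conjI ballI allI)
  let ?H = "comp_functor B G F"
  interpret B: category B by (rule B)
  show GF: "AMap ?H f \<in> Hom C (OMap ?H (Dom B f)) (OMap ?H (Cod B f))" if f: "f \<in> Arr B" for f
    using AMap_Hom[OF G AMap_Hom[OF F HomI[OF f refl refl]]] f B.Dom_closed B.Cod_closed
    by (simp add: comp_functor_def)
  show "OMap ?H \<in> Obj B \<rightarrow>\<^sub>E Obj C"
    using OMap_Obj[OF G OMap_Obj[OF F]] by (simp add: comp_functor_def)
  show "AMap ?H \<in> Arr B \<rightarrow>\<^sub>E Arr C"
    using HomD(1)[OF AMap_Hom[OF G AMap_Hom[OF F HomI]]] by (simp add: comp_functor_def)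
  show "AMap ?H (Ident B X) = Ident C (OMap ?H X)" if X: "X \<in> Obj B" for X
    using AMap_Ident[OF F X] AMap_Ident[OF G OMap_Obj[OF F X]] X HomD(1)[OF B.Ident_in_Hom[OF X]]
    by (simp add: comp_functor_def)
  show "AMap ?H (g \<odot>\<^bsub>B\<^esub> f) = AMap ?H g \<odot>\<^bsub>C\<^esub> AMap ?H f"
    if f: "f \<in> Hom B X Y" and g: "g \<in> Hom B Y Z" for X Y Z f g
    using AMap_Comp[OF F f g] AMap_Comp[OF G AMap_Hom[OF F f] AMap_Hom[OF F g]]
      HomD(1)[OF f] HomD(1)[OF g] HomD(1)[OF B.Comp_in_Hom[OF f g]]
    by (simp add: comp_functor_def)
qed

text \<open>The naturality square at \<open>f\<close> is that of \<open>t\<close> at the arrow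
  \<open>AMap S f\<close>.\<close>

lemma whisker_is_nat_trans:
  assumes t: "is_nat_trans J C t" and S: "is_functor B J S" and B: "category B"
  shows "is_nat_trans B C (whisker B t S)"
proof -
  interpret B: category B by (rule B)
  have "is_functor J C (Src t)" "is_functor J C (Tgt t)" using t by (auto simp: is_nat_trans_def)
  then have "is_functor B C (comp_functor B (Src t) S)" "is_functor B C (comp_functor B (Tgt t) S)"
    using comp_functor_is_functor[OF S _ B] by auto
  moreover have "Component t (OMap S X) \<in> Hom C (OMap (Src t) (OMap S X)) (OMap (Tgt t) (OMap S X))"
    if "X \<in> Obj B" for X
    by (rule Component_Hom[OF t OMap_Obj[OF S that]])
  moreover have "Component t (OMap S Y) \<odot>\<^bsub>C\<^esub> AMap (Src t) (AMap S f)
      = AMap (Tgt t) (AMap S f) \<odot>\<^bsub>C\<^esub> Component t (OMap S X)" if "f \<in> Hom B X Y" for f X Y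
    by (rule naturality[OF t AMap_Hom[OF S that]])
  ultimately show ?thesis
    using B.Hom_Obj HomD(1)[where C = B] unfolding is_nat_trans_def whisker_def
    by (auto simp: comp_functor_def)
qed

lemma id_functor_is_functor:
  assumes "category C" shows "is_functor C C (id_functor C)"
proof -
  interpret category C by (rule assms)
  show ?thesis
    using Dom_closed Cod_closed HomD(1)[OF Ident_in_Hom] HomD(1)[OF Comp_in_Hom] HomD(1)
    by (fastforce simp: is_functor_def id_functor_def Hom_def)
qed

text \<open>A strict equality is required: whiskering \<tau> by \<open>S\<close> ends in this
  composite, which must be \<open>S\<close> itself before \<sigma> can follow.\<close>

lemma comp_id_functor:
  assumes "is_functor B C S" shows "comp_functor B (id_functor C) S = S"
  using assms OMap_Obj[OF assms]
  by (intro func.equality extensionalityI[of _ "Obj B"] extensionalityI[of _ "Arr B"])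
    (auto simp: comp_functor_def id_functor_def is_functor_def PiE_def)

section \<open>Products of preradicals on representatives\<close>

abbreviation (in category) preradical_reps :: "('o, 'a, 'o, 'a) nat_trans set" where
  "preradical_reps \<equiv> monics_into (Fun C C) (id_functor C)"

definition (in category) rep_mult ::
  "('o, 'a, 'o, 'a) nat_trans \<Rightarrow> ('o, 'a, 'o, 'a) nat_trans \<Rightarrow> ('o, 'a, 'o, 'a) nat_trans" where
  "rep_mult \<tau> \<sigma> = \<sigma> \<odot>\<^bsub>Fun C C\<^esub> whisker C \<tau> (Src \<sigma>)"

context abelian_category
begin

interpretation F: functors_to_abelian C C ..
interpretation FC: category "Fun C C" by (rule F.category_Fun)

lemma preradical_repD:
  assumes "\<tau> \<in> preradical_reps"
  shows "is_nat_trans C C \<tau>" "Tgt \<tau> = id_functor C" "is_functor C C (Src \<tau>)"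
    and "X \<in> Obj C \<Longrightarrow> Component \<tau> X \<in> Hom C (OMap (Src \<tau>) X) X"
    and "X \<in> Obj C \<Longrightarrow> monic C (Component \<tau> X)"
    and "f \<in> Hom C X Y \<Longrightarrow> Component \<tau> Y \<odot> AMap (Src \<tau>) f = f \<odot> Component \<tau> X"
proof -
  show t: "is_nat_trans C C \<tau>" and id: "Tgt \<tau> = id_functor C"
    and "X \<in> Obj C \<Longrightarrow> monic C (Component \<tau> X)"
    using assms by (simp_all add: monics_into_def F.monic_Fun_iff)
  show "is_functor C C (Src \<tau>)" using t by (simp add: is_nat_trans_def)
  show "Component \<tau> X \<in> Hom C (OMap (Src \<tau>) X) X" if "X \<in> Obj C"
    using Component_Hom[OF t that] id that by (simp add: id_functor_def)
  show "Component \<tau> Y \<odot> AMap (Src \<tau>) f = f \<odot> Component \<tau> X" if "f \<in> Hom C X Y"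
    using naturality[OF t that] HomD(1)[OF that] id by (simp add: id_functor_def)
qed

lemma Component_rep_mult:
  "X \<in> Obj C \<Longrightarrow> Component (rep_mult \<tau> \<sigma>) X = Component \<sigma> X \<odot> Component \<tau> (OMap (Src \<sigma>) X)"
  by (simp add: rep_mult_def whisker_def)

lemma rep_mult_closed:
  assumes \<tau>: "\<tau> \<in> preradical_reps" and \<sigma>: "\<sigma> \<in> preradical_reps"
  shows "rep_mult \<tau> \<sigma> \<in> preradical_reps"
proof -
  note S = preradical_repD(3)[OF \<sigma>]
  have "is_nat_trans C C (rep_mult \<tau> \<sigma>)"
    unfolding rep_mult_def
    by (rule F.nat_trans_Comp[OF preradical_repD(1)[OF \<sigma>]
          whisker_is_nat_trans[OF preradical_repD(1)[OF \<tau>] S category_axioms]])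
      (simp add: whisker_def preradical_repD(2)[OF \<tau>] comp_id_functor[OF S])
  moreover have "monic C (Component (rep_mult \<tau> \<sigma>) X)" if X: "X \<in> Obj C" for X
    unfolding Component_rep_mult[OF X]
    using monic_Comp[OF preradical_repD(5)[OF \<sigma> X] preradical_repD(5)[OF \<tau> OMap_Obj[OF S X]]]
      HomD(2)[OF preradical_repD(4)[OF \<sigma> X]] HomD(3)[OF preradical_repD(4)[OF \<tau> OMap_Obj[OF S X]]]
    by simp
  moreover have "Tgt (rep_mult \<tau> \<sigma>) = id_functor C"
    using preradical_repD(2)[OF \<sigma>] by (simp add: rep_mult_def)
  ultimately show ?thesis by (simp add: monics_into_def F.monic_Fun_iff)
qed

text \<open>Components of \<sigma> are monic, so pointwise factorizations are natural without
  further work and the order is pointwise.\<close>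

lemma rep_le_iff:
  assumes \<tau>: "\<tau> \<in> preradical_reps" and \<sigma>: "\<sigma> \<in> preradical_reps"
  shows "factors_through (Fun C C) \<tau> \<sigma> \<longleftrightarrow>
    (\<forall>X \<in> Obj C. factors_through C (Component \<tau> X) (Component \<sigma> X))"
  using F.factors_through_FunI[of \<tau> \<sigma>] F.factors_through_FunD[of \<tau> \<sigma>]
    preradical_repD[OF \<tau>] preradical_repD[OF \<sigma>] by auto

text \<open>The component of \<tau> at the value of \<open>Src \<sigma>\<close> is the factorizing
  arrow. This is the half of idempotence that always holds.\<close>

lemma rep_mult_le:
  assumes \<tau>: "\<tau> \<in> preradical_reps" and \<sigma>: "\<sigma> \<in> preradical_reps"
  shows "factors_through (Fun C C) (rep_mult \<tau> \<sigma>) \<sigma>"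
  unfolding rep_le_iff[OF rep_mult_closed[OF \<tau> \<sigma>] \<sigma>]
proof
  fix X assume X: "X \<in> Obj C"
  note sX = preradical_repD(4)[OF \<sigma> X]
  note tSX = preradical_repD(4)[OF \<tau> Hom_Obj(1)[OF sX]]
  show "factors_through C (Component (rep_mult \<tau> \<sigma>) X) (Component \<sigma> X)"
    unfolding factors_through_def Component_rep_mult[OF X] HomD(2)[OF Comp_in_Hom[OF tSX sX]]
      HomD(2)[OF sX]
    using tSX by blast
qed

text \<open>Let \<open>u\<close> witness \<open>\<sigma> \<le> \<sigma>'\<close> at
  \<open>X\<close>, and let \<open>v\<close> witness \<open>\<tau> \<le> \<tau>'\<close> at the
  value of \<open>Src \<sigma>'\<close>. Naturality of \<tau> at \<open>u\<close> moves
  \<open>u\<close> to its right as \<open>AMap (Src \<tau>) u\<close>, after which \<open>v\<close>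
  applies; the factorizing arrow is \<open>v \<odot> AMap (Src \<tau>) u\<close>.\<close>

lemma rep_mult_mono:
  assumes reps: "\<tau> \<in> preradical_reps" "\<sigma> \<in> preradical_reps" "\<tau>' \<in> preradical_reps" "\<sigma>' \<in> preradical_reps"
    and le: "factors_through (Fun C C) \<tau> \<tau>'" "factors_through (Fun C C) \<sigma> \<sigma>'"
  shows "factors_through (Fun C C) (rep_mult \<tau> \<sigma>) (rep_mult \<tau>' \<sigma>')"
  unfolding rep_le_iff[OF rep_mult_closed[OF reps(1,2)] rep_mult_closed[OF reps(3,4)]]
proof
  fix X assume X: "X \<in> Obj C"
  let ?SX = "OMap (Src \<sigma>) X" and ?SX' = "OMap (Src \<sigma>') X"
  note sX = preradical_repD(4)[OF reps(2) X] and sX' = preradical_repD(4)[OF reps(4) X]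
  note tSX = preradical_repD(4)[OF reps(1) Hom_Obj(1)[OF sX]]
    and tSX' = preradical_repD(4)[OF reps(1) Hom_Obj(1)[OF sX']]
    and t'SX' = preradical_repD(4)[OF reps(3) Hom_Obj(1)[OF sX']]
  have "factors_through C (Component \<sigma> X) (Component \<sigma>' X)"
    using le(2) X unfolding rep_le_iff[OF reps(2,4)] by blast
  then obtain u where u: "u \<in> Hom C ?SX ?SX'" "Component \<sigma> X = Component \<sigma>' X \<odot> u"
    unfolding factors_through_def HomD(2)[OF sX] HomD(2)[OF sX'] by blast
  have "factors_through C (Component \<tau> ?SX') (Component \<tau>' ?SX')"
    using le(1) Hom_Obj(1)[OF sX'] unfolding rep_le_iff[OF reps(1,3)] by blast
  then obtain v where v: "v \<in> Hom C (OMap (Src \<tau>) ?SX') (OMap (Src \<tau>') ?SX')"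
    "Component \<tau> ?SX' = Component \<tau>' ?SX' \<odot> v"
    unfolding factors_through_def HomD(2)[OF tSX'] HomD(2)[OF t'SX'] by blast
  note Tu = AMap_Hom[OF preradical_repD(3)[OF reps(1)] u(1)]
  have "Component \<sigma> X \<odot> Component \<tau> ?SX = Component \<sigma>' X \<odot> (u \<odot> Component \<tau> ?SX)"
    unfolding u(2) by (rule Comp_assoc[OF tSX u(1) sX'])
  also have "u \<odot> Component \<tau> ?SX = Component \<tau> ?SX' \<odot> AMap (Src \<tau>) u"
    by (rule preradical_repD(6)[OF reps(1) u(1), symmetric])
  also have "\<dots> = Component \<tau>' ?SX' \<odot> (v \<odot> AMap (Src \<tau>) u)"
    unfolding v(2) by (rule Comp_assoc[OF Tu v(1) t'SX'])
  also have "Component \<sigma>' X \<odot> \<dots> = Component \<sigma>' X \<odot> Component \<tau>' ?SX' \<odot> (v \<odot> AMap (Src \<tau>) u)"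
    by (rule Comp_assoc[OF Comp_in_Hom[OF Tu v(1)] t'SX' sX', symmetric])
  finally show "factors_through C (Component (rep_mult \<tau> \<sigma>) X) (Component (rep_mult \<tau>' \<sigma>') X)"
    unfolding factors_through_def Component_rep_mult[OF X]
      HomD(2)[OF Comp_in_Hom[OF tSX sX]] HomD(2)[OF Comp_in_Hom[OF t'SX' sX']]
    using Comp_in_Hom[OF Tu v(1)] by blast
qed

text \<open>By monotonicity all products of representatives of \<open>P\<close> are equivalent, so
  the union defining \<open>preradical_mult\<close> is one class. With \<open>rep_mult_le\<close>,
  equality with \<open>P\<close> comes down to one inequality for one representative.\<close>

lemma idempotent_preradical_iff:
  assumes P: "P \<in> Sub (Fun C C) (id_functor C)" and \<tau>: "\<tau> \<in> P"
  shows "idempotent_preradical C P \<longleftrightarrow> factors_through (Fun C C) \<tau> (rep_mult \<tau> \<tau>)"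
proof
  let ?R = "subobject_rel (Fun C C) (id_functor C)"
  have rep: "\<rho> \<in> preradical_reps" if "\<rho> \<in> P" for \<rho> using FC.Sub_memberD(1)[OF P that] .
  have eq: "factors_through (Fun C C) \<rho> \<rho>'" if "\<rho> \<in> P" "\<rho>' \<in> P" for \<rho> \<rho>'
    using FC.Sub_memberD(2)[OF P that(1)] that(2) by (auto simp: subobject_rel_def)
  note arr = monics_intoD(3)
  have mult: "preradical_mult C P P = (\<Union>\<rho> \<in> P. \<Union>\<rho>' \<in> P. ?R `` {rep_mult \<rho> \<rho>'})"
    by (simp add: preradical_mult_def rep_mult_def)
  {
    assume "idempotent_preradical C P"
    then have "\<tau> \<in> preradical_mult C P P" using \<tau> by (simp add: idempotent_preradical_def)
    then obtain \<rho> \<rho>' where \<rho>: "\<rho> \<in> P" "\<rho>' \<in> P" "(rep_mult \<rho> \<rho>', \<tau>) \<in> ?R"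
      unfolding mult by blast
    have "factors_through (Fun C C) \<tau> (rep_mult \<rho> \<rho>')"
      using \<rho>(3) by (simp add: subobject_rel_def)
    moreover have "factors_through (Fun C C) (rep_mult \<rho> \<rho>') (rep_mult \<tau> \<tau>)"
      by (rule rep_mult_mono) (use \<rho> \<tau> rep eq in auto)
    ultimately show "factors_through (Fun C C) \<tau> (rep_mult \<tau> \<tau>)"
      using FC.factors_through_trans arr[OF rep_mult_closed[OF rep[OF \<tau>] rep[OF \<tau>]]] by blast
  next
    assume le: "factors_through (Fun C C) \<tau> (rep_mult \<tau> \<tau>)"
    have "(\<tau>, rep_mult \<rho> \<rho>') \<in> ?R" if \<rho>: "\<rho> \<in> P" "\<rho>' \<in> P" for \<rho> \<rho>'
    proof -
      note cl = rep_mult_closed[OF rep[OF \<rho>(1)] rep[OF \<rho>(2)]]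
      have "factors_through (Fun C C) (rep_mult \<tau> \<tau>) (rep_mult \<rho> \<rho>')"
        by (rule rep_mult_mono) (use \<rho> \<tau> rep eq in auto)
      then have "factors_through (Fun C C) \<tau> (rep_mult \<rho> \<rho>')"
        using FC.factors_through_trans[OF le] arr[OF cl] by blast
      moreover have "factors_through (Fun C C) (rep_mult \<rho> \<rho>') \<tau>"
        using FC.factors_through_trans[OF rep_mult_le[OF rep[OF \<rho>(1)] rep[OF \<rho>(2)]] eq[OF \<rho>(2) \<tau>]]
          arr[OF rep[OF \<tau>]] by blast
      ultimately show ?thesis using cl rep[OF \<tau>] by (simp add: subobject_rel_def)
    qed
    then have "?R `` {rep_mult \<rho> \<rho>'} = P" if "\<rho> \<in> P" "\<rho>' \<in> P" for \<rho> \<rho>'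
      using equiv_class_eq[OF FC.equiv_subobject_rel] FC.Sub_memberD(2)[OF P \<tau>] that by metis
    \<comment> \<open>Every term of the union is \<open>P\<close>, and \<tau> shows that the union
      is not empty.\<close>
    then have "preradical_mult C P P = P" unfolding mult using \<tau> by auto
    then show "idempotent_preradical C P"
      using P by (simp add: idempotent_preradical_def Pr_def subobject_order_def)
  }
qed

lemma ex_idempotent_lub:
  assumes cocomplete: "cocomplete_cat TYPE('u) C" and small: "locally_small TYPE('u) C"
    and Ps: "\<And>P. P \<in> Ps \<Longrightarrow> idempotent_preradical C P"
  shows "\<exists>P. is_lub (Pr C) P Ps \<and> idempotent_preradical C P"
proof -
  have sub: "Ps \<subseteq> Sub (Fun C C) (id_functor C)"
    using Ps by (auto simp: idempotent_preradical_def Pr_def subobject_order_def)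
  have rep: "s \<in> preradical_reps" if "s \<in> \<Union>Ps" for s
    using FC.Sub_memberD(1) sub that by blast
  then have "\<Union>Ps \<subseteq> preradical_reps" ..
  then obtain t where t: "t \<in> preradical_reps"
    and upper: "\<And>s. s \<in> \<Union>Ps \<Longrightarrow> factors_through (Fun C C) s t"
    and least: "\<And>n. \<lbrakk>n \<in> preradical_reps; \<And>s. s \<in> \<Union>Ps \<Longrightarrow> factors_through (Fun C C) s n\<rbrakk>
      \<Longrightarrow> factors_through (Fun C C) t n"
    by (rule F.join_in_Fun[OF cocomplete small id_functor_is_functor[OF category_axioms]]) iprover
  let ?T = "subobject_rel (Fun C C) (id_functor C) `` {t}"
  have "is_lub (Pr C) ?T Ps"
    unfolding Pr_def by (rule FC.is_lub_subobject_order[OF sub t upper least])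
  moreover have "factors_through (Fun C C) t (rep_mult t t)"
  proof (rule least[OF rep_mult_closed[OF t t]])
    fix s assume s: "s \<in> \<Union>Ps"
    then have "factors_through (Fun C C) s (rep_mult s s)"
      using idempotent_preradical_iff sub Ps by blast
    moreover have "factors_through (Fun C C) (rep_mult s s) (rep_mult t t)"
      by (rule rep_mult_mono) (use s t rep upper in blast)+
    ultimately show "factors_through (Fun C C) s (rep_mult t t)"
      using FC.factors_through_trans monics_intoD(3)[OF rep_mult_closed[OF t t]] by blast
  qed
  then have "idempotent_preradical C ?T"
    using idempotent_preradical_iff[OF FC.Sub_class[OF t] FC.class_self[OF t]] by simp
  ultimately show ?thesis by blast
qed

text \<open>The join \<open>\<Squnion>\<close> is a Hilbert choice among least upper bounds;
  uniqueness identifies it with the one constructed, so idempotence carries over.\<close>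

lemma is_lub_Pr_unique:
  assumes "is_lub (Pr C) P Ps" "is_lub (Pr C) Q Ps"
  shows "P = Q"
proof (rule FC.subobject_le_antisym[of _ "id_functor C"])
  show "P \<in> Sub (Fun C C) (id_functor C)" "Q \<in> Sub (Fun C C) (id_functor C)"
    using assms by (auto simp: least_def Upper_def Pr_def subobject_order_def)
qed (use assms in \<open>auto simp: least_def Pr_def\<close>)

end

theorem proposition7p8:
  fixes A :: "('o, 'a, 'm) preadd_cat_scheme"
    and I :: "'i set"
    and \<sigma> :: "'i \<Rightarrow> ('o, 'a) preradical"
  assumes "abelian_category A"
    and "bicomplete_cat TYPE('u) A"
    and "locally_small TYPE('u) A"
    and "\<And>i. i \<in> I \<Longrightarrow> idempotent_preradical A (\<sigma> i)"
  shows "is_lub (Pr A) (\<Squnion>\<^bsub>Pr A\<^esub> (\<sigma> ` I)) (\<sigma> ` I) \<and>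
         idempotent_preradical A (\<Squnion>\<^bsub>Pr A\<^esub> (\<sigma> ` I))"
proof -
  interpret abelian_category A by (rule assms(1))
  obtain P where P: "is_lub (Pr A) P (\<sigma> ` I)" "idempotent_preradical A P"
    using ex_idempotent_lub[of "\<sigma> ` I"] assms(2,3,4) unfolding bicomplete_cat_def by blast
  have "is_lub (Pr A) (\<Squnion>\<^bsub>Pr A\<^esub> (\<sigma> ` I)) (\<sigma> ` I)"
    unfolding sup_def using P(1) by (rule someI)
  then show ?thesis using is_lub_Pr_unique[OF P(1)] P(2) by blast
qed

end
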